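(* Let $n,k,t,r$ be positive integers with $r\geq 3$, $t+r\leq k$, and $\max\left\{\binom{t+r}{2},\frac{k-t-r+4}{2}\right\}\cdot(k-t-r+3)^2+t+r-2\leq n$. Suppose $\mathcal{F}\subseteq\binom{[n]}{k}$ is a non-trivial $r$-wise $t$-intersecting family. (i) If $2t+2r-2<k$ and $|\mathcal{F}|>h_1(t+r-2,k,n)$, then $\mathcal{F}\subseteq\mathcal{H}(k,t+r-1,X,M)$ for some $(k+1)$-subset $M$ of $[n]$ and some $(t+r-2)$-subset $X$ of $M$. (ii) If either $k\leq 2t+2r-2<2k-2$ and $|\mathcal{F}|>h_1(t+r-2,k,n)$, or $2t+2r-2=2k-2$ and $|\mathcal{F}|\geq h_1(t+r-2,k,k+1)$, then $\mathcal{F}$ is a subfamily of $\mathcal{H}(k,t+r-1,X,M)$ for some $(k+1)$-subset $M$ of $[n]$ and some $(t+r-2)$-subset $X$ of $M$, or a subfamily of $\mathcal{A}(k,t+r-1,Z)$ for some $(t+r)$-subset $Z$ of $[n]$.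
   Context: $[n]=\{1,\dots,n\}$ and $\binom{V}{k}$ denotes the family of $k$-subsets of a set $V$. A family $\mathcal{F}\subseteq\binom{[n]}{k}$ is $r$-wise $t$-intersecting if $|F_1\cap\cdots\cap F_r|\geq t$ for all $F_1,\dots,F_r\in\mathcal{F}$; it is trivial if all its members contain a common $t$-subset of $[n]$, and non-trivial otherwise. For positive integers $k>d$, $M\in\binom{[n]}{k+1}$, $X\in\binom{M}{d}$, $Z\in\binom{[n]}{d+2}$: $\mathcal{H}(k,d+1,X,M)=\{H\in\binom{[n]}{k}: X\subseteq H,\ |H\cap M|\geq d+1\}\cup\binom{M}{k}$, $\mathcal{A}(k,d+1,Z)=\{A\in\binom{[n]}{k}: |A\cap Z|\geq d+1\}$. $h_1(d,k,c)=\binom{n-d}{k-d}-\binom{n-k}{k-d}+\binom{n-c}{2k-c-d}+d(c-k)$, with binomial coefficients $\binom{a}{b}=0$ when $b<0$ or $b>a$. *)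

theory Defs
  imports Complex_Main "HOL-Library.Ramsey" "HOL-Library.FuncSet"
begin

text \<open>
  The \<open>k\<close>-subsets of \<open>V\<close> are written \<open>[V]\<^bsup>k\<^esup>\<close> (\<^const>\<open>nsets\<close>), and the ground set is \<open>{1..n}\<close>.
\<close>

text \<open>The sets \<open>F\<^sub>1, \<dots>, F\<^sub>r\<close> need not be distinct; only \<open>r > 0\<close> is meaningful.\<close>

definition wise_intersecting :: "nat \<Rightarrow> nat \<Rightarrow> 'a set set \<Rightarrow> bool" where
  "wise_intersecting r t \<F> \<longleftrightarrow> (\<forall>F \<in> {1..r} \<rightarrow> \<F>. t \<le> card (\<Inter>i\<in>{1..r}. F i))"

definition trivial_family :: "nat \<Rightarrow> nat \<Rightarrow> nat set set \<Rightarrow> bool" where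
  "trivial_family n t \<F> \<longleftrightarrow> (\<exists>T \<in> [{1..n}]\<^bsup>t\<^esup>. \<forall>F\<in>\<F>. T \<subseteq> F)"

text \<open>The argument \<open>s\<close> in the next two definitions plays the role of \<open>d + 1\<close>.\<close>

definition fam_H :: "nat \<Rightarrow> nat \<Rightarrow> nat \<Rightarrow> nat set \<Rightarrow> nat set \<Rightarrow> nat set set" where
  "fam_H n k s X M = {H \<in> [{1..n}]\<^bsup>k\<^esup>. X \<subseteq> H \<and> s \<le> card (H \<inter> M)} \<union> [M]\<^bsup>k\<^esup>"

definition fam_A :: "nat \<Rightarrow> nat \<Rightarrow> nat \<Rightarrow> nat set \<Rightarrow> nat set set" where
  "fam_A n k s Z = {A \<in> [{1..n}]\<^bsup>k\<^esup>. s \<le> card (A \<inter> Z)}"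

text \<open>
  Integer arguments are used because the lower index \<open>2k - c - d\<close> in \<open>h1\<close> is typically negative,
  which truncated subtraction on \<^typ>\<open>nat\<close> would turn into \<open>0\<close>.
\<close>

definition ibinom :: "int \<Rightarrow> int \<Rightarrow> int" where
  "ibinom a b = (if b < 0 \<or> b > a then 0 else int (nat a choose nat b))"

definition h1 :: "nat \<Rightarrow> nat \<Rightarrow> nat \<Rightarrow> nat \<Rightarrow> int" where
  "h1 n d k c =
     ibinom (int n - int d) (int k - int d) - ibinom (int n - int k) (int k - int d)
     + ibinom (int n - int c) (2 * int k - int c - int d) + int d * (int c - int k)"

end

theory Submission
  imports Defs
begin

text \<open>
  Put \<open>d = t + r - 2\<close> and \<open>l = k - d\<close>. If \<open>m\<close> members of a non-trivial \<open>(m + 1)\<close>-wise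
  \<open>s\<close>-intersecting family met in exactly \<open>s\<close> points, those points would lie in every member; hence
  \<open>\<F>\<close> is 3-wise \<open>(d - 1)\<close>-intersecting and pairwise \<open>d\<close>-intersecting, and it may be taken maximal
  with the first property. Call \<open>T\<close> a cover if it meets every member in at least \<open>d\<close> points; every
  cover has more than \<open>d\<close> points. If a set \<open>S\<close> is not a cover, then some \<open>l + 1\<close> points outside \<open>S\<close>
  meet every member containing \<open>S\<close>, so branching over them bounds \<open>\<F>\<close> by the number of members
  containing slightly larger sets. This makes \<open>\<F>\<close> small unless there is a cover of size \<open>d + 1\<close>.
  By maximality every \<open>k\<close>-set containing such a cover lies in \<open>\<F>\<close>, so the covers of size \<open>d + 1\<close>
  pairwise meet in at least \<open>d\<close> points. Either they lie in a common \<open>(d + 2)\<close>-set \<open>Z\<close> without forming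
  a star, and \<open>\<F>\<close> is contained in \<open>\<A>(Z)\<close>; or they are \<open>X \<union> {m}\<close> for \<open>m\<close> in a set of \<open>q \<le> l + 1\<close>
  points. For \<open>q = l + 1\<close> one gets \<open>\<H>(X, M)\<close>, for \<open>q < l\<close> branching shows that \<open>\<F>\<close> is small, and for
  \<open>q = l\<close> the 3-wise condition rules out all competitors of \<open>\<H>(X, M)\<close> except a family of size
  exactly \<open>h1(d, k, n)\<close>, which for \<open>l = 2\<close> lies in some \<open>\<A>(Z)\<close>.
\<close>

section \<open>Covers and branching\<close>

lemma nsetsI: "finite V \<Longrightarrow> A \<subseteq> V \<Longrightarrow> card A = k \<Longrightarrow> A \<in> [V]\<^bsup>k\<^esup>"
  by (auto simp: nsets_def finite_subset)

lemma card_supersets_le: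
  assumes "finite V" "S \<subseteq> V" "\<And>A. A \<in> \<A> \<Longrightarrow> A \<in> [V]\<^bsup>k\<^esup> \<and> S \<subseteq> A"
  shows "card \<A> \<le> (card V - card S) choose (k - card S)"
proof -
  have fS: "finite S" using assms finite_subset by blast
  have "(\<lambda>A. A - S) ` \<A> \<subseteq> [V - S]\<^bsup>(k - card S)\<^esup>"
    using assms(3) fS by (fastforce simp: nsets_def card_Diff_subset)
  moreover have "inj_on (\<lambda>A. A - S) \<A>"
    using assms(3) by (auto simp: inj_on_def)
  ultimately have "card \<A> \<le> card ([V - S]\<^bsup>(k - card S)\<^esup>)"
    using assms(1) by (meson card_inj_on_le finite_Diff finite_imp_finite_nsets)
  then show ?thesis
    using assms(1,2) fS by (simp add: card_nsets card_Diff_subset)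
qed

lemma card_supersets_meeting_le:
  assumes "finite V" "S \<subseteq> V" "W \<subseteq> V" "S \<inter> W = {}"
    and "\<And>A. A \<in> \<A> \<Longrightarrow> A \<in> [V]\<^bsup>k\<^esup> \<and> S \<subseteq> A \<and> A \<inter> W \<noteq> {}"
  shows "card \<A> \<le> ((card V - card S) choose (k - card S))
                   - ((card V - card S - card W) choose (k - card S))"
proof -
  let ?j = "k - card S"
  have fin: "finite S" "finite W" using assms finite_subset by blast+
  have "(\<lambda>A. A - S) ` \<A> \<subseteq> [V - S]\<^bsup>?j\<^esup> - [V - S - W]\<^bsup>?j\<^esup>"
  proof
    fix B assume "B \<in> (\<lambda>A. A - S) ` \<A>"
    then obtain A where A: "A \<in> \<A>" "B = A - S" by blast
    note p = assms(5)[OF A(1)]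
    have "A - S \<in> [V - S]\<^bsup>?j\<^esup>"
      using p fin by (auto simp: nsets_def card_Diff_subset)
    moreover have "\<not> A - S \<subseteq> V - S - W" using p assms(4) by blast
    ultimately show "B \<in> [V - S]\<^bsup>?j\<^esup> - [V - S - W]\<^bsup>?j\<^esup>"
      using A by (auto simp: nsets_def)
  qed
  moreover have "inj_on (\<lambda>A. A - S) \<A>"
    using assms(5) by (auto simp: inj_on_def)
  ultimately have "card \<A> \<le> card ([V - S]\<^bsup>?j\<^esup> - [V - S - W]\<^bsup>?j\<^esup>)"
    using assms(1) by (meson card_inj_on_le finite_Diff finite_imp_finite_nsets)
  also have "\<dots> = card ([V - S]\<^bsup>?j\<^esup>) - card ([V - S - W]\<^bsup>?j\<^esup>)"
    using assms(1) by (intro card_Diff_subset finite_imp_finite_nsets nsets_mono) auto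
  also have "card ([V - S - W]\<^bsup>?j\<^esup>) = (card V - card S - card W) choose ?j"
  proof -
    have "card (V - S - W) = card V - card S - card W"
      using assms(1-4) fin by (subst card_Diff_subset) (auto simp: card_Diff_subset)
    then show ?thesis using assms(1) by (simp add: card_nsets)
  qed
  finally show ?thesis
    using assms(1,2) fin by (simp add: card_nsets card_Diff_subset)
qed

lemma card_UN_le_mult:
  assumes "finite I" "\<And>i. i \<in> I \<Longrightarrow> card (f i) \<le> c"
  shows "card (\<Union>i\<in>I. f i) \<le> card I * c"
proof -
  have "card (\<Union>i\<in>I. f i) \<le> (\<Sum>i\<in>I. card (f i))" by (rule card_UN_le[OF assms(1)])
  also have "\<dots> \<le> card I * c" using assms(2) sum_bounded_above[of I "\<lambda>i. card (f i)" c] by simp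
  finally show ?thesis .
qed

lemma obtain_nset_between:
  assumes "finite V" "S \<subseteq> V" "S \<inter> W = {}" "card S \<le> k" "k + card W \<le> card V" "W \<subseteq> V"
  obtains A where "A \<in> [V]\<^bsup>k\<^esup>" "S \<subseteq> A" "A \<inter> W = {}"
proof -
  have fin: "finite S" "finite W" using assms finite_subset by blast+
  have "card (V - W - S) = card V - card W - card S"
    using assms fin by (subst card_Diff_subset) (auto simp: card_Diff_subset)
  then have "k - card S \<le> card (V - W - S)" using assms by simp
  then obtain B where B: "B \<subseteq> V - W - S" "card B = k - card S" "finite B"
    by (rule obtain_subset_with_card_n)
  show ?thesis
  proof
    have "card (S \<union> B) = k" using B fin assms(4) by (subst card_Un_disjoint) auto
    then show "S \<union> B \<in> [V]\<^bsup>k\<^esup>" using B assms(1,2) by (intro nsetsI) auto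
    show "S \<subseteq> S \<union> B" by simp
    show "(S \<union> B) \<inter> W = {}" using B assms(3) by blast
  qed
qed

section \<open>Families whose members pairwise share \<open>d\<close> points\<close>

locale pairwise_intersecting =
  fixes V :: "'a set" and \<F> :: "'a set set" and d l :: nat
  assumes finite_V: "finite V"
    and \<F>_nsets: "\<F> \<subseteq> [V]\<^bsup>(d + l)\<^esup>"
    and pair: "A \<in> \<F> \<Longrightarrow> B \<in> \<F> \<Longrightarrow> d \<le> card (A \<inter> B)"
begin

abbreviation star :: "'a set \<Rightarrow> 'a set set" where
  "star S \<equiv> {A \<in> \<F>. S \<subseteq> A}"

definition cover :: "'a set \<Rightarrow> bool" where
  "cover T \<longleftrightarrow> T \<subseteq> V \<and> (\<forall>A\<in>\<F>. d \<le> card (T \<inter> A))"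

lemma memD:
  assumes "A \<in> \<F>"
  shows "A \<subseteq> V" "finite A" "card A = d + l"
  using assms \<F>_nsets by (auto simp: nsets_def)

lemma finite_\<F>: "finite \<F>"
  using \<F>_nsets finite_V finite_imp_finite_nsets finite_subset by metis

lemma mem_cover: "A \<in> \<F> \<Longrightarrow> cover A"
  using memD pair by (auto simp: cover_def)

text \<open>\<open>B\<close> shares at least \<open>d\<close> of the \<open>d + l\<close> points of
  \<open>A\<close>, so it misses at most \<open>l\<close> of them. Every branching step rests on
  this.\<close>

lemma hit:
  assumes "A \<in> \<F>" "B \<in> \<F>" "W \<subseteq> A" "l < card W"
  shows "W \<inter> B \<noteq> {}"
proof
  assume "W \<inter> B = {}"
  then have "W \<subseteq> A - B" using assms by blast
  then have "card W \<le> card (A - B)" using memD(2)[OF assms(1)] by (simp add: card_mono)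
  also have "\<dots> = card A - card (A \<inter> B)" using memD(2)[OF assms(1)] by (simp add: card_Diff_subset_Int)
  also have "\<dots> \<le> l" using memD(3)[OF assms(1)] pair[OF assms(1,2)] by simp
  finally show False using assms(4) by simp
qed

lemma card_star_le:
  assumes "S \<subseteq> V"
  shows "card (star S) \<le> (card V - card S) choose (d + l - card S)"
  using assms finite_V \<F>_nsets by (intro card_supersets_le) auto

lemma star_branch:
  assumes "A \<in> \<F>" "W \<subseteq> A" "l < card W"
  shows "star S \<subseteq> (\<Union>a\<in>W. star (insert a S))"
proof
  fix B assume B: "B \<in> star S"
  then obtain a where "a \<in> W" "a \<in> B" using hit[OF assms(1) _ assms(2,3), of B] by blast
  then show "B \<in> (\<Union>a\<in>W. star (insert a S))" using B by blast
qed

text \<open>A member witnessing that \<open>S\<close> is no cover has at least \<open>l + 1\<close>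
  points outside \<open>S\<close>, and by \<open>hit\<close> any \<open>l + 1\<close> of them meet
  every member through \<open>S\<close>. Fixing one more point thus costs a factor
  \<open>l + 1\<close>.\<close>

lemma card_star_branch_le:
  assumes "S \<subseteq> V" "\<not> cover S" and c: "\<And>a. a \<in> V - S \<Longrightarrow> card (star (insert a S)) \<le> c"
  shows "card (star S) \<le> (l + 1) * c"
proof -
  obtain A where A: "A \<in> \<F>" "card (S \<inter> A) < d"
    using assms by (auto simp: cover_def not_le)
  have "card (A - S) = card A - card (S \<inter> A)"
    using memD(2)[OF A(1)] by (simp add: card_Diff_subset_Int Int_commute)
  then have "l + 1 \<le> card (A - S)" using A memD(3)[OF A(1)] by simp
  then obtain W where W: "W \<subseteq> A - S" "card W = l + 1" "finite W"
    by (rule obtain_subset_with_card_n)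
  have "card (star S) \<le> card (\<Union>a\<in>W. star (insert a S))"
    using W A star_branch[of A W S] by (intro card_mono finite_subset[OF _ finite_\<F>]) auto
  also have "\<dots> \<le> card W * c"
    using W memD(1)[OF A(1)] by (intro card_UN_le_mult c) auto
  finally show ?thesis using W by simp
qed

text \<open>Below size \<open>m\<close> nothing is a cover, so branching can be repeated up to size
  \<open>m\<close>, where the trivial bound \<open>card_star_le\<close> takes over.\<close>

lemma card_star_iterated_branch_le:
  assumes "\<And>T. cover T \<Longrightarrow> m \<le> card T" "S \<subseteq> V" "card S + j = m"
  shows "card (star S) \<le> (l + 1) ^ j * ((card V - m) choose (d + l - m))"
  using assms(2,3)
proof (induction j arbitrary: S)
  case 0
  then show ?case using card_star_le[of S] by simp
next
  case (Suc j)
  have fS: "finite S" using Suc.prems finite_V finite_subset by blast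
  have "\<not> cover S" using assms(1)[of S] Suc.prems by auto
  moreover have "card (star (insert a S)) \<le> (l + 1) ^ j * ((card V - m) choose (d + l - m))"
    if "a \<in> V - S" for a
    using that Suc.prems fS by (intro Suc.IH) auto
  ultimately show ?case
    unfolding power_Suc mult.assoc by (intro card_star_branch_le[OF Suc.prems(1)])
qed

text \<open>The unit of the later estimates: one branching step from \<open>d + 1\<close> to
  \<open>d + 2\<close> points.\<close>

lemma card_star_Suc_le:
  assumes "S \<subseteq> V" "card S = d + 1" "\<not> cover S"
  shows "card (star S) \<le> (l + 1) * ((card V - d - 2) choose (l - 2))"
proof (rule card_star_branch_le[OF assms(1,3)])
  fix a assume a: "a \<in> V - S"
  have "finite S" using assms finite_V finite_subset by blast
  then have "card (insert a S) = d + 2" using a assms by simp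
  then show "card (star (insert a S)) \<le> (card V - d - 2) choose (l - 2)"
    using card_star_le[of "insert a S"] a assms(1) by simp
qed

lemma card_le_of_minimal_cover:
  assumes "cover T" "card T = m" "d \<le> m" "\<And>T. cover T \<Longrightarrow> m \<le> card T"
  shows "card \<F> \<le> (m choose d) * (l + 1) ^ (m - d) * ((card V - m) choose (d + l - m))"
proof -
  have fT: "finite T" using assms(1) finite_V finite_subset unfolding cover_def by blast
  have "\<F> \<subseteq> (\<Union>S\<in>[T]\<^bsup>d\<^esup>. star S)"
  proof
    fix A assume A: "A \<in> \<F>"
    then have "d \<le> card (T \<inter> A)" using assms(1) by (auto simp: cover_def)
    then obtain S where S: "S \<subseteq> T \<inter> A" "card S = d" "finite S"
      by (rule obtain_subset_with_card_n)
    then show "A \<in> (\<Union>S\<in>[T]\<^bsup>d\<^esup>. star S)" using A by (auto simp: nsets_def)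
  qed
  then have "card \<F> \<le> card (\<Union>S\<in>[T]\<^bsup>d\<^esup>. star S)"
    by (intro card_mono finite_subset[OF _ finite_\<F>]) auto
  also have "\<dots> \<le> card ([T]\<^bsup>d\<^esup>) * ((l + 1) ^ (m - d) * ((card V - m) choose (d + l - m)))"
  proof (rule card_UN_le_mult)
    fix S assume "S \<in> [T]\<^bsup>d\<^esup>"
    then show "card (star S) \<le> (l + 1) ^ (m - d) * ((card V - m) choose (d + l - m))"
      using assms by (intro card_star_iterated_branch_le) (auto simp: cover_def nsets_def)
  qed (simp add: fT finite_imp_finite_nsets)
  finally show ?thesis using assms(2) fT by (simp add: card_nsets mult.assoc)
qed

end

section \<open>Covers of size d + 1\<close>

text \<open>Maximality is recorded only through its consequence \<open>saturated\<close>;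
  \<open>not_all_contain\<close> is non-triviality at level \<open>d - 1\<close>.\<close>

locale saturated_family = pairwise_intersecting +
  assumes d_ge: "2 \<le> d" and l_ge: "2 \<le> l" and V_ge: "2 * (d + l) \<le> card V"
    and triple: "A \<in> \<F> \<Longrightarrow> B \<in> \<F> \<Longrightarrow> C \<in> \<F> \<Longrightarrow> d - 1 \<le> card (A \<inter> B \<inter> C)"
    and not_all_contain: "S \<subseteq> V \<Longrightarrow> card S = d - 1 \<Longrightarrow> \<exists>A\<in>\<F>. \<not> S \<subseteq> A"
    and saturated: "cover T \<Longrightarrow> card T = d + 1 \<Longrightarrow> B \<in> [V]\<^bsup>(d + l)\<^esup> \<Longrightarrow> T \<subseteq> B \<Longrightarrow> B \<in> \<F>"
begin

text \<open>\<open>fam_H\<close> restated for an arbitrary ground set \<open>V\<close> and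
  \<open>k = d + l\<close>, since the locale is not tied to natural numbers; likewise
  \<open>within_A\<close> for \<open>fam_A\<close>.\<close>

definition within_H :: bool where
  "within_H \<longleftrightarrow> (\<exists>M \<in> [V]\<^bsup>(d + l + 1)\<^esup>. \<exists>X \<in> [M]\<^bsup>d\<^esup>.
     \<F> \<subseteq> {H \<in> [V]\<^bsup>(d + l)\<^esup>. X \<subseteq> H \<and> d + 1 \<le> card (H \<inter> M)} \<union> [M]\<^bsup>(d + l)\<^esup>)"

definition within_A :: bool where
  "within_A \<longleftrightarrow> (\<exists>Z \<in> [V]\<^bsup>(d + 2)\<^esup>. \<F> \<subseteq> {A \<in> [V]\<^bsup>(d + l)\<^esup>. d + 1 \<le> card (A \<inter> Z)})"

lemma not_all_contain_ge:
  assumes "S \<subseteq> V" "d - 1 \<le> card S"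
  obtains A where "A \<in> \<F>" "\<not> S \<subseteq> A"
proof -
  obtain S' where S': "S' \<subseteq> S" "card S' = d - 1" "finite S'"
    using assms(2) by (rule obtain_subset_with_card_n)
  then obtain A where "A \<in> \<F>" "\<not> S' \<subseteq> A"
    using not_all_contain[of S'] assms(1) by blast
  then show ?thesis using that S'(1) by blast
qed

lemma finite_sub: "S \<subseteq> V \<Longrightarrow> finite S"
  using finite_V finite_subset by blast

lemma cover_sub: "cover T \<Longrightarrow> T \<subseteq> V" and cover_card: "cover T \<Longrightarrow> A \<in> \<F> \<Longrightarrow> d \<le> card (T \<inter> A)"
  by (auto simp: cover_def)

text \<open>A cover with at most \<open>d\<close> points lies in every member; having at least
  \<open>d - 1\<close> points, it would contradict non-triviality.\<close>

lemma cover_card_ge: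
  assumes "cover T"
  shows "d + 1 \<le> card T"
proof (rule ccontr)
  assume "\<not> d + 1 \<le> card T"
  then have le: "card T \<le> d" by simp
  note fT = finite_sub[OF cover_sub[OF assms]]
  have sub: "T \<subseteq> A" if "A \<in> \<F>" for A
  proof -
    have "T \<inter> A = T"
      using cover_card[OF assms that] le fT by (intro card_seteq) auto
    then show ?thesis by blast
  qed
  \<comment> \<open>Applied to \<open>V\<close> itself, non-triviality just provides some
    member.\<close>
  have "d - 1 \<le> card V" using V_ge by simp
  then obtain A where "A \<in> \<F>" using not_all_contain_ge[of V] by blast
  then have "d \<le> card T" using cover_card[OF assms] fT card_mono[of T "T \<inter> A"] by fastforce
  then have "d - 1 \<le> card T" by simp
  then obtain B where "B \<in> \<F>" "\<not> T \<subseteq> B"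
    using not_all_contain_ge[OF cover_sub[OF assms]] by blast
  then show False using sub by blast
qed

text \<open>Saturation supplies a member containing \<open>T\<close> and avoiding
  \<open>T' - T\<close>; \<open>T'\<close> meets it exactly in \<open>T \<inter> T'\<close>.\<close>

lemma covers_meet:
  assumes "cover T" "card T = d + 1" "cover T'" "card T' = d + 1"
  shows "d \<le> card (T \<inter> T')"
proof -
  note sub = cover_sub[OF assms(1)] cover_sub[OF assms(3)]
  have "card (T' - T) \<le> d + 1"
    using card_mono[of T' "T' - T"] finite_sub[OF sub(2)] assms(4) by auto
  then have "(d + l) + card (T' - T) \<le> card V" using V_ge l_ge by simp
  then obtain B where B: "B \<in> [V]\<^bsup>(d + l)\<^esup>" "T \<subseteq> B" "B \<inter> (T' - T) = {}"
    using obtain_nset_between[OF finite_V sub(1), of "T' - T" "d + l"] assms(2) l_ge sub(2) by auto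
  have "B \<in> \<F>" using saturated[OF assms(1,2) B(1,2)] .
  then have "d \<le> card (T' \<inter> B)" using cover_card[OF assms(3)] by blast
  also have "T' \<inter> B = T \<inter> T'" using B by blast
  finally show ?thesis .
qed

text \<open>Write \<open>T1 = X \<union> {a}\<close> and \<open>T2 = X \<union> {b}\<close>. Since
  \<open>T3\<close> omits a point \<open>x\<close> of \<open>X\<close>, it must contain the rest of
  \<open>T1\<close> and \<open>T2\<close>, in particular \<open>a\<close> and \<open>b\<close>. The
  set \<open>Z\<close> is \<open>X \<union> {a, b}\<close>.\<close>

lemma within_A_if_covers_no_star:
  assumes T: "cover T1" "card T1 = d + 1" "cover T2" "card T2 = d + 1" "cover T3" "card T3 = d + 1"
    and "T1 \<noteq> T2" "\<not> T1 \<inter> T2 \<subseteq> T3"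
  shows within_A
proof -
  let ?X = "T1 \<inter> T2"
  note sub = cover_sub[OF T(1)] cover_sub[OF T(3)] cover_sub[OF T(5)]
  note fin = finite_sub[OF sub(1)] finite_sub[OF sub(2)] finite_sub[OF sub(3)]
  have "card ?X \<noteq> d + 1"
  proof
    assume "card ?X = d + 1"
    then have "?X = T1" "?X = T2" using T(2,4) fin by (intro card_subset_eq; simp)+
    then show False using assms(7) by blast
  qed
  moreover have "card ?X \<le> d + 1" using card_mono[of T1 ?X] fin T(2) by auto
  ultimately have cX: "card ?X = d" using covers_meet[OF T(1-4)] by simp
  have "card (T1 - ?X) = 1" "card (T2 - ?X) = 1"
    using cX T(2,4) fin by (auto simp: card_Diff_subset)
  then obtain a b where "T1 - ?X = {a}" "T2 - ?X = {b}" by (meson card_1_singletonE)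
  then have T12: "T1 = insert a ?X" "T2 = insert b ?X" and ab: "a \<notin> ?X" "b \<notin> ?X" "a \<noteq> b"
    by blast+
  obtain x where x: "x \<in> ?X" "x \<notin> T3" using assms(8) by blast
  have drop: "T - {x} \<subseteq> T3" if "cover T" "card T = d + 1" "x \<in> T" for T
  proof -
    have "T \<inter> T3 = T - {x}"
    proof (rule card_seteq)
      show "finite (T - {x})" using finite_sub[OF cover_sub[OF that(1)]] by simp
      show "T \<inter> T3 \<subseteq> T - {x}" using x by blast
      show "card (T - {x}) \<le> card (T \<inter> T3)"
        using covers_meet[OF that(1,2) T(5,6)] that(2,3) by simp
    qed
    then show ?thesis by blast
  qed
  have in3: "a \<in> T3" "b \<in> T3"
    using drop[OF T(1,2)] drop[OF T(3,4)] x ab T12 by blast+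
  let ?Z = "insert a (insert b ?X)"
  have cZ: "card ?Z = d + 2" using cX ab fin by simp
  have "d + 1 \<le> card (A \<inter> ?Z)" if A: "A \<in> \<F>" for A
  proof (rule ccontr)
    assume "\<not> d + 1 \<le> card (A \<inter> ?Z)"
    then have le: "card (A \<inter> ?Z) \<le> d" by simp
    \<comment> \<open>If \<open>A\<close> met \<open>?Z\<close> in at most \<open>d\<close> points,
      they would all lie in both \<open>T1\<close> and \<open>T2\<close>, so \<open>A\<close> would
      avoid \<open>a\<close> and \<open>b\<close> and meet \<open>T3\<close> in at most
      \<open>d - 1\<close> points.\<close>
    have eq: "A \<inter> ?Z = T \<inter> A" if "cover T" "T \<subseteq> ?Z" for T
      using cover_card[OF that(1) A] le fin(1) that(2) by (intro card_seteq[symmetric]) auto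
    have "b \<notin> A" using eq[OF T(1)] T12 ab by blast
    moreover have "a \<notin> A" using eq[OF T(3)] T12 ab by blast
    ultimately have "T3 \<inter> A \<subseteq> T3 - {a, b}" by blast
    moreover have "card (T3 - {a, b}) = d - 1" using in3 ab(3) T(6) fin by (simp add: card_Diff_subset)
    ultimately have "card (T3 \<inter> A) \<le> d - 1" using fin by (metis card_mono finite_Diff)
    then show False using cover_card[OF T(5) A] d_ge by simp
  qed
  moreover have "?Z \<in> [V]\<^bsup>(d + 2)\<^esup>" using sub T12 cZ finite_V by (intro nsetsI) blast+
  ultimately show ?thesis unfolding within_A_def using \<F>_nsets by blast
qed

end

section \<open>The covers of size \<open>d + 1\<close> as a star with centre
  \<open>X\<close>\<close>

text \<open>\<open>M\<close> is disjoint from \<open>X\<close>: the set called \<open>M\<close> in \<open>fam_H\<close> is \<open>X \<union> M\<close>, possibly with one more point.\<close>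

locale star_of_covers = saturated_family +
  fixes X M
  assumes X_sub: "X \<subseteq> V" and card_X: "card X = d"
    and M_sub: "M \<subseteq> V" and disjoint: "X \<inter> M = {}" and M_ne: "M \<noteq> {}"
    and covers: "\<And>T. card T = d + 1 \<Longrightarrow> cover T \<longleftrightarrow> (\<exists>m\<in>M. T = insert m X)"
begin

lemma finite_X: "finite X" and finite_M: "finite M"
  using X_sub M_sub by (auto intro: finite_sub)

text \<open>As \<open>A\<close> misses part of \<open>X\<close>, meeting the cover
  \<open>insert m X\<close> in \<open>d\<close> points forces \<open>m \<in> A\<close> and lets
  \<open>A\<close> miss only one point of \<open>X\<close>.\<close>

lemma not_superset:
  assumes "A \<in> \<F>" "\<not> X \<subseteq> A"
  shows "M \<subseteq> A" "\<exists>x\<in>X. A \<inter> X = X - {x}"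
proof -
  have ins: "m \<in> A \<and> d \<le> card (X \<inter> A) + 1" if m: "m \<in> M" for m
  proof -
    have mX: "m \<notin> X" using disjoint m by blast
    have "card (insert m X) = d + 1" using mX finite_X card_X by simp
    then have "cover (insert m X)" using covers m by blast
    then have *: "d \<le> card (insert m X \<inter> A)" using cover_card assms(1) by blast
    have lt: "card (X \<inter> A) < d"
      using psubset_card_mono[of X "X \<inter> A"] finite_X card_X assms(2) by blast
    have "m \<in> A" using * lt by (cases "m \<in> A") auto
    then show ?thesis using * finite_X mX by simp
  qed
  then show "M \<subseteq> A" by blast
  obtain m where "m \<in> M" using M_ne by blast
  then have ge: "d \<le> card (X \<inter> A) + 1" using ins by blast
  obtain x where x: "x \<in> X" "x \<notin> A" using assms(2) by blast
  have "X \<inter> A = X - {x}"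
    using x ge finite_X card_X by (intro card_seteq) auto
  then show "\<exists>x\<in>X. A \<inter> X = X - {x}" using x by blast
qed

lemma card_diff_X:
  assumes "A \<in> \<F>" "\<not> X \<subseteq> A"
  shows "card (A - X) = l + 1"
proof -
  obtain x where "x \<in> X" "A \<inter> X = X - {x}" using not_superset(2)[OF assms] by blast
  then have "card (A \<inter> X) = d - 1" using finite_X card_X by simp
  then show ?thesis using memD(2,3)[OF assms(1)] d_ge by (simp add: card_Diff_subset_Int)
qed

lemma obtain_not_superset:
  obtains A where "A \<in> \<F>" "\<not> X \<subseteq> A" "card (A - X) = l + 1" "M \<subseteq> A - X"
proof -
  obtain A where A: "A \<in> \<F>" "\<not> X \<subseteq> A"
    using not_all_contain_ge[OF X_sub] card_X by auto
  then show ?thesis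
    using that card_diff_X[OF A] not_superset(1)[OF A] disjoint by blast
qed

lemma card_M_le: "card M \<le> l + 1"
proof -
  obtain A where "card (A - X) = l + 1" "M \<subseteq> A - X" by (rule obtain_not_superset)
  then show ?thesis by (metis card_gt_0_iff card_mono zero_less_Suc Suc_eq_plus1)
qed

lemma card_X_Un: "Y \<inter> X = {} \<Longrightarrow> finite Y \<Longrightarrow> card (X \<union> Y) = d + card Y"
  using finite_X card_X by (subst card_Un_disjoint) auto

text \<open>\<open>X \<union> Y\<close> plays the role of the \<open>(k + 1)\<close>-set. The
  criterion is applied with \<open>Y = M\<close> if \<open>card M = l + 1\<close>, and with
  \<open>M\<close> plus one point if \<open>card M = l\<close>.\<close>

lemma within_HI:
  assumes Y: "Y \<subseteq> V" "Y \<inter> X = {}" "card Y = l + 1"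
    and out: "\<And>A. A \<in> \<F> \<Longrightarrow> \<not> X \<subseteq> A \<Longrightarrow> A \<subseteq> X \<union> Y"
    and meet: "\<And>A. A \<in> \<F> \<Longrightarrow> X \<subseteq> A \<Longrightarrow> A \<inter> Y \<noteq> {}"
  shows within_H
  unfolding within_H_def
proof (intro bexI)
  have fY: "finite Y" using Y finite_sub by blast
  show "X \<union> Y \<in> [V]\<^bsup>(d + l + 1)\<^esup>"
    using card_X_Un[OF Y(2) fY] X_sub Y finite_V by (intro nsetsI) auto
  show "X \<in> [X \<union> Y]\<^bsup>d\<^esup>" using finite_X card_X by (auto simp: nsets_def)
  show "\<F> \<subseteq> {H \<in> [V]\<^bsup>(d + l)\<^esup>. X \<subseteq> H \<and> d + 1 \<le> card (H \<inter> (X \<union> Y))} \<union> [X \<union> Y]\<^bsup>(d + l)\<^esup>"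
  proof
    fix A assume A: "A \<in> \<F>"
    show "A \<in> {H \<in> [V]\<^bsup>(d + l)\<^esup>. X \<subseteq> H \<and> d + 1 \<le> card (H \<inter> (X \<union> Y))} \<union> [X \<union> Y]\<^bsup>(d + l)\<^esup>"
    proof (cases "X \<subseteq> A")
      case True
      then obtain y where y: "y \<in> A" "y \<in> Y" using meet[OF A] by blast
      then have "insert y X \<subseteq> A \<inter> (X \<union> Y)" using True by blast
      then have "card (insert y X) \<le> card (A \<inter> (X \<union> Y))"
        using memD(2)[OF A] by (intro card_mono) auto
      moreover have "card (insert y X) = d + 1"
        using y Y(2) finite_X card_X by (subst card_insert_disjoint) auto
      ultimately show ?thesis using A True \<F>_nsets by auto
    next
      case False
      then show ?thesis using out[OF A] memD[OF A] by (auto simp: nsets_def)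
    qed
  qed
qed

text \<open>For a member \<open>A\<close> not containing \<open>X\<close>, the \<open>l + 1\<close>
  points of \<open>A - X\<close> are exactly \<open>M\<close>; and \<open>M\<close>, as
  \<open>l + 1\<close> points of a member, meets every member.\<close>

lemma within_H_if_card_M: "card M = l + 1 \<Longrightarrow> within_H"
proof (rule within_HI[of M])
  assume q: "card M = l + 1"
  show "A \<subseteq> X \<union> M" if A: "A \<in> \<F>" "\<not> X \<subseteq> A" for A
  proof -
    have "M \<subseteq> A - X" using not_superset(1)[OF A] disjoint by blast
    then have "M = A - X"
      using card_diff_X[OF A] q memD(2)[OF A(1)] by (intro card_subset_eq) auto
    then show ?thesis by blast
  qed
  obtain B where B: "B \<in> \<F>" "\<not> X \<subseteq> B" "M \<subseteq> B - X" by (rule obtain_not_superset)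
  show "A \<inter> M \<noteq> {}" if "A \<in> \<F>" "X \<subseteq> A" for A
  proof -
    have "M \<subseteq> B" using B(3) by blast
    then show ?thesis using hit[OF B(1) that(1), of M] q by (simp add: Int_commute)
  qed
qed (use M_sub disjoint in auto)

lemma not_superset_shape:
  assumes "card M = l" "A \<in> \<F>" "\<not> X \<subseteq> A"
  obtains x y where "x \<in> X" "y \<in> V - (X \<union> M)" "A = insert y ((X - {x}) \<union> M)"
proof -
  obtain x where x: "x \<in> X" "A \<inter> X = X - {x}" using not_superset(2)[OF assms(2,3)] by blast
  have M: "M \<subseteq> A - X" using not_superset(1)[OF assms(2,3)] disjoint by blast
  have "card (A - X - M) = 1"
    using card_diff_X[OF assms(2,3)] assms(1) M finite_M by (subst card_Diff_subset) auto
  then obtain y where y: "A - X - M = {y}" by (rule card_1_singletonE)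
  have "A = insert y ((X - {x}) \<union> M)" using x y M by blast
  then show ?thesis using that[OF x(1)] y memD(1)[OF assms(2)] by blast
qed

text \<open>Here the 3-wise condition enters. Two members that omit different points of
  \<open>X\<close> and have different extra points would meet jointly with \<open>B\<close> in at
  most \<open>d - 2\<close> points. Hence all extra points coincide, and this point completes
  \<open>M\<close> to \<open>l + 1\<close> points.\<close>

lemma within_H_if_superset_avoiding_M:
  assumes q: "card M = l" and B: "B \<in> \<F>" "X \<subseteq> B" "B \<inter> M = {}"
  shows within_H
proof -
  obtain A1 where A1: "A1 \<in> \<F>" "\<not> X \<subseteq> A1" by (rule obtain_not_superset)
  obtain x1 y1 where 1: "x1 \<in> X" "y1 \<in> V - (X \<union> M)" "A1 = insert y1 ((X - {x1}) \<union> M)"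
    by (rule not_superset_shape[OF q A1])
  have c1: "card (X - {x1}) = d - 1" using 1 card_X finite_X by simp
  \<comment> \<open>\<open>X - {x1}\<close> has \<open>d - 1\<close> points, so by non-triviality
    some member omits a different point of \<open>X\<close>.\<close>
  obtain A2 where A2: "A2 \<in> \<F>" "\<not> X - {x1} \<subseteq> A2"
    using not_all_contain_ge[of "X - {x1}"] c1 X_sub by auto
  have "\<not> X \<subseteq> A2" using A2(2) by blast
  from not_superset_shape[OF q A2(1) this] obtain x2 y2
    where 2: "x2 \<in> X" "y2 \<in> V - (X \<union> M)" "A2 = insert y2 ((X - {x2}) \<union> M)" by blast
  have ne: "x1 \<noteq> x2" using A2(2) 2 by blast
  have same: "y = y'" if "insert y ((X - {x}) \<union> M) \<in> \<F>" "insert y' ((X - {x'}) \<union> M) \<in> \<F>"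
      "x \<in> X" "x' \<in> X" "x \<noteq> x'" "y \<notin> X" "y' \<notin> X" for x y x' y'
  proof (rule ccontr)
    assume "y \<noteq> y'"
    then have "insert y ((X - {x}) \<union> M) \<inter> insert y' ((X - {x'}) \<union> M) \<inter> B \<subseteq> X - {x, x'}"
      using B(3) that(6,7) by blast
    then have "card (insert y ((X - {x}) \<union> M) \<inter> insert y' ((X - {x'}) \<union> M) \<inter> B) \<le> card (X - {x, x'})"
      using finite_X by (intro card_mono) auto
    also have "\<dots> = d - 2" using that(3-5) card_X finite_X by (simp add: card_Diff_subset)
    finally show False using triple[OF that(1,2) B(1)] d_ge by simp
  qed
  have y12: "y1 = y2" using same[of y1 x1 y2 x2] A1 A2 1 2 ne by blast
  show ?thesis
  proof (rule within_HI[of "insert y1 M"])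
    show "A \<subseteq> X \<union> insert y1 M" if A: "A \<in> \<F>" "\<not> X \<subseteq> A" for A
    proof -
      obtain x y where xy: "x \<in> X" "y \<in> V - (X \<union> M)" "A = insert y ((X - {x}) \<union> M)"
        by (rule not_superset_shape[OF q A])
      have "y = y1"
      \<comment> \<open>A member omitting the same point as \<open>A1\<close> is compared with
        \<open>A2\<close> instead.\<close>
      proof (cases "x = x1")
        case True
        then show ?thesis using same[of y x y2 x2] A A2 xy 2 ne y12 by blast
      next
        case False
        then show ?thesis using same[of y x y1 x1] A A1 xy 1 by blast
      qed
      then show ?thesis using xy by blast
    qed
    show "A \<inter> insert y1 M \<noteq> {}" if A: "A \<in> \<F>" "X \<subseteq> A" for A
    proof
      assume "A \<inter> insert y1 M = {}"
      then have "A \<inter> A1 \<subseteq> X - {x1}" using 1 by blast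
      then have "card (A \<inter> A1) \<le> d - 1" using c1 finite_X by (metis card_mono finite_Diff)
      then show False using pair[OF A(1) A1(1)] d_ge by simp
    qed
  qed (use M_sub 1 disjoint q finite_M in auto)
qed

lemma split_\<F>: "card \<F> = card {A \<in> \<F>. X \<subseteq> A} + card {A \<in> \<F>. \<not> X \<subseteq> A}"
  using finite_\<F> by (subst card_Un_disjoint[symmetric]) (auto intro!: arg_cong[of _ _ card])

lemma card_supersets_meeting_M:
  "card {A \<in> \<F>. X \<subseteq> A \<and> A \<inter> M \<noteq> {}}
     \<le> ((card V - d) choose l) - ((card V - d - card M) choose l)"
  using card_supersets_meeting_le[OF finite_V X_sub M_sub disjoint, of "{A \<in> \<F>. X \<subseteq> A \<and> A \<inter> M \<noteq> {}}" "d + l"]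
    \<F>_nsets card_X by auto

text \<open>If no member contains \<open>X\<close> and avoids \<open>M\<close>, the members
  containing \<open>X\<close> give the main term, and each other one is determined by its omitted
  and its extra point. For \<open>card V > d + 2 * l\<close> the bound is the value of
  \<open>h1\<close> at \<open>c = n\<close>. For \<open>l = 2\<close> the set
  \<open>X \<union> M\<close> serves as \<open>Z\<close>.\<close>

lemma card_M_eq_l_cases:
  assumes q: "card M = l"
  shows "within_H \<or>
    card \<F> \<le> ((card V - d) choose l) - ((card V - d - l) choose l) + d * (card V - d - l) \<and>
    (l = 2 \<longrightarrow> within_A)"
proof (cases "\<exists>B\<in>\<F>. X \<subseteq> B \<and> B \<inter> M = {}")
  case True
  then show ?thesis using within_H_if_superset_avoiding_M[OF q] by blast
next
  case False
  then have eq: "{A \<in> \<F>. X \<subseteq> A} = {A \<in> \<F>. X \<subseteq> A \<and> A \<inter> M \<noteq> {}}" by blast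
  let ?f = "\<lambda>(x, y). insert y ((X - {x}) \<union> M)"
  have sub: "{A \<in> \<F>. \<not> X \<subseteq> A} \<subseteq> ?f ` (X \<times> (V - (X \<union> M)))"
  proof
    fix A assume "A \<in> {A \<in> \<F>. \<not> X \<subseteq> A}"
    then obtain x y where "x \<in> X" "y \<in> V - (X \<union> M)" "A = insert y ((X - {x}) \<union> M)"
      using not_superset_shape[OF q, of A] by blast
    then show "A \<in> ?f ` (X \<times> (V - (X \<union> M)))" by (intro image_eqI[of _ _ "(x, y)"]) auto
  qed
  have fin: "finite (X \<times> (V - (X \<union> M)))" using finite_X finite_V by simp
  have "card {A \<in> \<F>. \<not> X \<subseteq> A} \<le> card (X \<times> (V - (X \<union> M)))"
    using card_mono[OF finite_imageI[OF fin] sub] card_image_le[OF fin, of ?f] by linarith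
  also have "\<dots> = d * (card V - d - l)"
    using card_X_Un[of M] disjoint finite_M q X_sub M_sub finite_X card_X
    by (subst card_cartesian_product, subst card_Diff_subset) (auto simp: Int_commute)
  finally have "card \<F> \<le> ((card V - d) choose l) - ((card V - d - l) choose l) + d * (card V - d - l)"
    using split_\<F> card_supersets_meeting_M unfolding eq q by linarith
  moreover have within_A if "l = 2"
    unfolding within_A_def
  proof (intro bexI)
    show "X \<union> M \<in> [V]\<^bsup>(d + 2)\<^esup>"
      using card_X_Un[of M] disjoint finite_M q X_sub M_sub finite_V that by (intro nsetsI) auto
    show "\<F> \<subseteq> {A \<in> [V]\<^bsup>(d + l)\<^esup>. d + 1 \<le> card (A \<inter> (X \<union> M))}"
    proof
      fix A assume A: "A \<in> \<F>"
      have "d + 1 \<le> card (A \<inter> (X \<union> M))"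
      proof (cases "X \<subseteq> A")
        case True
        then obtain m where m: "m \<in> M" "m \<in> A" using False A by blast
        have "card (insert m X) \<le> card (A \<inter> (X \<union> M))"
          using memD(2)[OF A] m True by (intro card_mono) auto
        moreover have "card (insert m X) = d + 1"
          using m disjoint finite_X card_X by (subst card_insert_disjoint) auto
        ultimately show ?thesis by simp
      next
        case False
        then obtain x y where xy: "x \<in> X" "y \<in> V - (X \<union> M)" "A = insert y ((X - {x}) \<union> M)"
          by (rule not_superset_shape[OF q A])
        then have "A \<inter> (X \<union> M) = (X - {x}) \<union> M" by blast
        moreover have "card ((X - {x}) \<union> M) = d - 1 + 2"
          using xy finite_X finite_M disjoint q that card_X by (subst card_Un_disjoint) auto
        ultimately show ?thesis using d_ge by simp
      qed
      then show "A \<in> {A \<in> [V]\<^bsup>(d + l)\<^esup>. d + 1 \<le> card (A \<inter> (X \<union> M))}" using A \<F>_nsets by blast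
    qed
  qed
  ultimately show ?thesis by blast
qed

text \<open>Members through \<open>X\<close> that meet \<open>M\<close> are counted directly. Those
  through \<open>X\<close> avoiding \<open>M\<close>, and those not containing \<open>X\<close>, lie
  in stars of \<open>(d + 1)\<close>-sets that are no covers, which are small by
  \<open>card_star_Suc_le\<close>.\<close>

lemma card_le_if_card_M_ge_2:
  assumes q: "2 \<le> card M" "card M \<le> l"
  shows "card \<F> \<le> ((card V - d) choose l) - ((card V - d - card M) choose l)
    + (l + 1 - card M + d) * ((l + 1) * ((card V - d - 2) choose (l - 2)))"
proof -
  let ?c = "(l + 1) * ((card V - d - 2) choose (l - 2))"
  obtain B where B: "B \<in> \<F>" "\<not> X \<subseteq> B" "card (B - X) = l + 1" "M \<subseteq> B - X"
    by (rule obtain_not_superset)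
  note BD = memD[OF B(1)]
  have avoid: "card {A \<in> \<F>. X \<subseteq> A \<and> A \<inter> M = {}} \<le> (l + 1 - card M) * ?c"
  proof -
    have "{A \<in> \<F>. X \<subseteq> A \<and> A \<inter> M = {}} \<subseteq> (\<Union>b\<in>B - X - M. star (insert b X))"
    proof
      fix A assume A: "A \<in> {A \<in> \<F>. X \<subseteq> A \<and> A \<inter> M = {}}"
      have "(B - X) \<inter> A \<noteq> {}" using hit[OF B(1), of A "B - X"] A B(3) by auto
      then show "A \<in> (\<Union>b\<in>B - X - M. star (insert b X))" using A by blast
    qed
    then have "card {A \<in> \<F>. X \<subseteq> A \<and> A \<inter> M = {}} \<le> card (\<Union>b\<in>B - X - M. star (insert b X))"
      by (intro card_mono finite_subset[OF _ finite_\<F>]) auto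
    also have "\<dots> \<le> card (B - X - M) * ?c"
    proof (rule card_UN_le_mult)
      fix b assume b: "b \<in> B - X - M"
      have cb: "card (insert b X) = d + 1" using b finite_X card_X by simp
      have "\<not> cover (insert b X)"
      proof
        assume "cover (insert b X)"
        then obtain m where "m \<in> M" "insert b X = insert m X" using covers[OF cb] by blast
        then have "b \<in> insert m X" by auto
        then show False using b \<open>m \<in> M\<close> by simp
      qed
      then show "card (star (insert b X)) \<le> ?c"
        using b BD X_sub by (intro card_star_Suc_le[OF _ cb]) auto
    qed (use BD in auto)
    also have "card (B - X - M) = l + 1 - card M"
      using B finite_M by (subst card_Diff_subset) auto
    finally show ?thesis .
  qed
  \<comment> \<open>Two points of \<open>M\<close> bring \<open>X - {x}\<close> to size
    \<open>d + 1\<close>; the result misses \<open>x\<close> and so is no cover.\<close>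
  obtain P where P: "P \<subseteq> M" "card P = 2" "finite P"
    using q(1) by (rule obtain_subset_with_card_n)
  have out: "card {A \<in> \<F>. \<not> X \<subseteq> A} \<le> d * ?c"
  proof -
    have "{A \<in> \<F>. \<not> X \<subseteq> A} \<subseteq> (\<Union>x\<in>X. star ((X - {x}) \<union> P))"
    proof
      fix A assume A: "A \<in> {A \<in> \<F>. \<not> X \<subseteq> A}"
      then obtain x where "x \<in> X" "A \<inter> X = X - {x}" using not_superset(2)[of A] by blast
      moreover have "M \<subseteq> A" using A not_superset(1)[of A] by blast
      ultimately show "A \<in> (\<Union>x\<in>X. star ((X - {x}) \<union> P))" using A P(1) by blast
    qed
    then have "card {A \<in> \<F>. \<not> X \<subseteq> A} \<le> card (\<Union>x\<in>X. star ((X - {x}) \<union> P))"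
      by (intro card_mono finite_subset[OF _ finite_\<F>]) auto
    also have "\<dots> \<le> card X * ?c"
    proof (rule card_UN_le_mult[OF finite_X])
      fix x assume x: "x \<in> X"
      have c: "card ((X - {x}) \<union> P) = d + 1"
        using x finite_X card_X P disjoint d_ge by (subst card_Un_disjoint) auto
      have "\<not> cover ((X - {x}) \<union> P)"
      proof
        assume "cover ((X - {x}) \<union> P)"
        then obtain m where "(X - {x}) \<union> P = insert m X" using covers[OF c] by blast
        then have "x \<in> (X - {x}) \<union> P" using x by simp
        then show False using x P(1) disjoint by blast
      qed
      then show "card (star ((X - {x}) \<union> P)) \<le> ?c"
        using X_sub P(1) M_sub by (intro card_star_Suc_le[OF _ c]) auto
    qed
    finally show ?thesis by (simp only: card_X)
  qed
  have "{A \<in> \<F>. X \<subseteq> A} = {A \<in> \<F>. X \<subseteq> A \<and> A \<inter> M \<noteq> {}} \<union> {A \<in> \<F>. X \<subseteq> A \<and> A \<inter> M = {}}"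
    (is "_ = ?L \<union> ?R") by blast
  then have "card {A \<in> \<F>. X \<subseteq> A}
    \<le> card {A \<in> \<F>. X \<subseteq> A \<and> A \<inter> M \<noteq> {}} + card {A \<in> \<F>. X \<subseteq> A \<and> A \<inter> M = {}}"
    using card_Un_le[of ?L ?R] by (simp only:)
  with avoid out card_supersets_meeting_M show ?thesis
    unfolding split_\<F> distrib_right by linarith
qed

end

section \<open>A single cover of size \<open>d + 1\<close>\<close>

context saturated_family
begin

text \<open>A member contains \<open>T\<close> or misses exactly one point \<open>x\<close> of it.
  In the latter case it contains \<open>T - {x}\<close> and, by \<open>hit\<close>, a further point
  of some member \<open>B\<close> not containing \<open>T - {x}\<close>; the resulting
  \<open>(d + 1)\<close>-set differs from \<open>T\<close>, so it is no cover.\<close>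

lemma card_le_if_unique_cover:
  assumes T: "cover T" "card T = d + 1"
    and unique: "\<And>T'. cover T' \<Longrightarrow> card T' = d + 1 \<Longrightarrow> T' = T"
  shows "card \<F> \<le> ((card V - d - 1) choose (l - 1))
    + (d + 1) * (l * ((l + 1) * ((card V - d - 2) choose (l - 2))))"
proof -
  let ?c = "(l + 1) * ((card V - d - 2) choose (l - 2))"
  note sub = cover_sub[OF T(1)] and fT = finite_sub[OF cover_sub[OF T(1)]]
  have each: "card {A \<in> \<F>. A \<inter> T = T - {x}} \<le> l * ?c" if x: "x \<in> T" for x
  proof -
    let ?S = "T - {x}"
    have cS: "card ?S = d" using x T(2) fT by simp
    obtain B where B: "B \<in> \<F>" "\<not> ?S \<subseteq> B"
      using not_all_contain_ge[of ?S] cS sub by auto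
    note BD = memD[OF B(1)]
    obtain z where z: "z \<in> ?S" "z \<notin> B" using B(2) by blast
    have BT: "T \<inter> B = T - {z}"
      using z cover_card[OF T(1) B(1)] T(2) fT by (intro card_seteq) auto
    have "card (T \<inter> B) = d" using BT z T(2) fT by simp
    then have cBT: "card (B - T) = l" using BD by (simp add: card_Diff_subset_Int Int_commute)
    \<comment> \<open>\<open>B\<close> misses only \<open>z\<close> in \<open>T\<close> and
      therefore contains \<open>x\<close>. As \<open>A\<close> omits \<open>x\<close>, only the
      other \<open>l\<close> of these \<open>l + 1\<close> points can lie in
      \<open>A\<close>.\<close>
    have "B - ?S = insert x (B - T)" using BT x z by blast
    then have cBS: "card (B - ?S) = l + 1" using cBT BD x by simp
    have "{A \<in> \<F>. A \<inter> T = ?S} \<subseteq> (\<Union>b\<in>B - T. star (insert b ?S))"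
    proof
      fix A assume A: "A \<in> {A \<in> \<F>. A \<inter> T = ?S}"
      have "(B - ?S) \<inter> A \<noteq> {}" using hit[OF B(1), of A "B - ?S"] A cBS by auto
      then show "A \<in> (\<Union>b\<in>B - T. star (insert b ?S))" using A x by blast
    qed
    then have "card {A \<in> \<F>. A \<inter> T = ?S} \<le> card (\<Union>b\<in>B - T. star (insert b ?S))"
      by (intro card_mono finite_subset[OF _ finite_\<F>]) auto
    also have "\<dots> \<le> card (B - T) * ?c"
    proof (rule card_UN_le_mult)
      fix b assume b: "b \<in> B - T"
      have cb: "card (insert b ?S) = d + 1" using b cS fT by simp
      have "\<not> cover (insert b ?S)" using unique[OF _ cb] b by blast
      then show "card (star (insert b ?S)) \<le> ?c"
        using b BD sub by (intro card_star_Suc_le[OF _ cb]) auto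
    qed (use BD in auto)
    finally show ?thesis unfolding cBT .
  qed
  have "\<F> \<subseteq> star T \<union> (\<Union>x\<in>T. {A \<in> \<F>. A \<inter> T = T - {x}})"
  proof
    fix A assume A: "A \<in> \<F>"
    show "A \<in> star T \<union> (\<Union>x\<in>T. {A \<in> \<F>. A \<inter> T = T - {x}})"
    proof (cases "T \<subseteq> A")
      case False
      then obtain x where x: "x \<in> T" "x \<notin> A" by blast
      have "A \<inter> T = T - {x}"
        using x cover_card[OF T(1) A] T(2) fT by (intro card_seteq) (auto simp: Int_commute)
      then show ?thesis using x A by blast
    qed (use A in blast)
  qed
  then have "card \<F> \<le> card (star T \<union> (\<Union>x\<in>T. {A \<in> \<F>. A \<inter> T = T - {x}}))"
    by (intro card_mono finite_subset[OF _ finite_\<F>]) auto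
  also have "\<dots> \<le> card (star T) + card (\<Union>x\<in>T. {A \<in> \<F>. A \<inter> T = T - {x}})"
    by (rule card_Un_le)
  also have "card (\<Union>x\<in>T. {A \<in> \<F>. A \<inter> T = T - {x}}) \<le> card T * (l * ?c)"
    by (rule card_UN_le_mult[OF fT each])
  also have "card (star T) \<le> (card V - d - 1) choose (l - 1)"
    using card_star_le[OF sub] T(2) by simp
  finally show ?thesis by (simp only: T(2) add_le_cancel_left add_le_cancel_right)
qed

end

section \<open>Binomial estimates\<close>

lemma two_times_choose_two: "2 * ((d + 2) choose 2) = (d + 2) * (d + 1)" for d :: nat
  by (simp add: choose_two)

lemma choose_two_ge: "2 \<le> d \<Longrightarrow> 2 * (d + 1) \<le> (d + 2) choose 2" for d :: nat
proof -
  assume "2 \<le> d"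
  then have "4 * (d + 1) \<le> (d + 2) * (d + 1)" by (intro mult_right_mono) auto
  then show ?thesis using two_times_choose_two[of d] by linarith
qed

text \<open>From one cover size to the next, the first binomial grows by
  \<open>(d + 3 + j) / (j + 3) \<le> d + 1\<close>, branching adds a factor \<open>l + 1\<close>,
  and the last binomial changes by \<open>y / w\<close> with
  \<open>(d + 1) * (l + 1) * y \<le> w\<close>. So size \<open>d + 2\<close> is the worst
  case.\<close>

lemma binomial_cover_bound_antimono:
  assumes d: "2 \<le> d" and N: "((d + 2) choose 2) * (l + 1)^2 + d \<le> n" and "2 + j \<le> l"
  shows "((d + 2 + j) choose d) * (l + 1) ^ (2 + j) * ((n - (d + 2 + j)) choose (l - (2 + j)))
    \<le> ((d + 2) choose 2) * (l + 1)^2 * ((n - d - 2) choose (l - 2))"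
  using assms(3)
proof (induction j)
  case 0
  have "(d + 2) choose d = (d + 2) choose 2" by (subst binomial_symmetric) auto
  then show ?case by simp
next
  case (Suc j)
  define a a' w y where "a = (d + 2 + j) choose d" and "a' = (d + 2 + Suc j) choose d"
    and "w = n - (d + 2 + j)" and "y = l - (2 + j)"
  define c c' where "c = w choose y" and "c' = (w - 1) choose (y - 1)"
  have a: "(j + 3) * a' = (d + 3 + j) * a"
    using binomial_absorb_comp[of "d + 2 + Suc j" d] unfolding a_def a'_def
    by (simp add: numeral_3_eq_3)
  have y: "0 < y" using Suc.prems by (simp add: y_def)
  have c: "w * c' = y * c"
    using times_binomial_minus1_eq[OF y, of w] unfolding c_def c'_def by simp
  have "2 * (d + 1) * (l + 1)^2 \<le> ((d + 2) choose 2) * (l + 1)^2"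
    using choose_two_ge[OF d] by (intro mult_right_mono) auto
  then have n: "2 * ((d + 1) * (l + 1)^2) + d \<le> n" using N by simp
  have "l \<le> (d + 1) * (l + 1)^2"
    using mult_mono[of 1 "d + 1" l "(l + 1)^2"] by (simp add: power2_eq_square)
  then have w_ge: "(d + 1) * (l + 1)^2 \<le> w" using n Suc.prems unfolding w_def by linarith
  have "(d + 1) * (l + 1) * y \<le> (d + 1) * (l + 1) * (l + 1)"
    unfolding y_def by (intro mult_left_mono) auto
  also have "\<dots> \<le> w" using w_ge by (simp only: power2_eq_square mult.assoc)
  finally have yw: "(d + 1) * (l + 1) * y \<le> w" .
  have "(d + 3 + j) * ((l + 1) * y) \<le> ((j + 3) * (d + 1)) * ((l + 1) * y)"
    by (intro mult_right_mono) auto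
  also have "\<dots> \<le> (j + 3) * w"
    using mult_left_mono[OF yw, of "j + 3"] by (simp only: mult.assoc)
  finally have key: "(d + 3 + j) * ((l + 1) * y) \<le> (j + 3) * w" .
  have w: "0 < w" using w_ge by (rule less_le_trans[rotated]) simp
  have "((j + 3) * w) * (a' * (l + 1) * c') = ((j + 3) * a') * (w * c') * (l + 1)"
    by (simp only: mult_ac)
  also have "\<dots> = ((d + 3 + j) * ((l + 1) * y)) * (a * c)" unfolding a c by (simp only: mult_ac)
  also have "\<dots> \<le> ((j + 3) * w) * (a * c)" by (rule mult_right_mono[OF key]) simp
  finally have "a' * (l + 1) * c' \<le> a * c" using w by simp
  then have "(l + 1) ^ (2 + j) * (a' * (l + 1) * c') \<le> (l + 1) ^ (2 + j) * (a * c)"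
    by (rule mult_left_mono) simp
  also have "\<dots> \<le> ((d + 2) choose 2) * (l + 1)^2 * ((n - d - 2) choose (l - 2))"
    using Suc.IH Suc.prems unfolding a_def c_def w_def y_def by (simp add: mult_ac)
  finally have *: "(l + 1) ^ (2 + j) * (a' * (l + 1) * c')
    \<le> ((d + 2) choose 2) * (l + 1)^2 * ((n - d - 2) choose (l - 2))" .
  have "w - 1 = n - (d + 2 + Suc j)" "y - 1 = l - (2 + Suc j)" by (simp_all add: w_def y_def)
  moreover have pw: "(l + 1) ^ (2 + Suc j) = (l + 1) ^ (2 + j) * (l + 1)" by simp
  ultimately have "((d + 2 + Suc j) choose d) * (l + 1) ^ (2 + Suc j)
      * ((n - (d + 2 + Suc j)) choose (l - (2 + Suc j))) = (l + 1) ^ (2 + j) * (a' * (l + 1) * c')"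
    unfolding a'_def c'_def pw by (simp only: mult_ac)
  then show ?case using * by simp
qed

section \<open>Lower bounds for the main term of \<open>h1\<close>\<close>

text \<open>\<open>N\<close> stands for \<open>n - d\<close>. \<open>N1\<close> and
  \<open>N2\<close> come from the two entries of the maximum in the theorem, the second doubled to
  clear the fraction.\<close>

locale binomial_bounds =
  fixes N d l :: nat
  assumes d: "2 \<le> d" and l: "2 \<le> l"
    and N1: "((d + 2) choose 2) * (l + 1)^2 \<le> N" and N2: "(l + 2) * (l + 1)^2 \<le> 2 * N"
begin

text \<open>The numbers of \<open>k\<close>-sets through \<open>d + 1\<close> and through
  \<open>d + 2\<close> fixed points, as integers because differences of them occur.\<close>

abbreviation "C1 \<equiv> int ((N - 1) choose (l - 1))"
abbreviation "C2 \<equiv> int ((N - 2) choose (l - 2))"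

lemma N_ge: "2 * (d + 1) * (l + 1)^2 \<le> N"
proof -
  have "2 * (d + 1) * (l + 1)^2 \<le> ((d + 2) choose 2) * (l + 1)^2"
    using choose_two_ge[OF d] by (intro mult_right_mono) auto
  then show ?thesis using N1 by linarith
qed

lemma N_ge_int: "2 * (int d + 1) * (int l + 1)^2 \<le> int N"
  using of_nat_mono[OF N_ge, where 'a = int]
  by (simp only: of_nat_mult of_nat_add of_nat_power of_nat_numeral of_nat_1)

lemma N2_int: "(int l + 2) * (int l + 1)^2 \<le> 2 * int N"
  using of_nat_mono[OF N2, where 'a = int]
  by (simp only: of_nat_mult of_nat_add of_nat_power of_nat_numeral of_nat_1)

lemma l_le_N: "2 * l + 2 \<le> N"
proof -
  have "(2 * l + 2) * 1 \<le> (2 * (d + 1) * (l + 1)) * (l + 1)" by (intro mult_mono) auto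
  then show ?thesis using N_ge by (simp add: power2_eq_square)
qed

lemma d_plus_l_le: "2 * (d + l + 1) \<le> N"
proof -
  have "d + l + 1 \<le> (d + 1) * (l + 1)" by simp
  then have "2 * (d + l + 1) * 1 \<le> (2 * ((d + 1) * (l + 1))) * (l + 1)" by (intro mult_mono) auto
  then show ?thesis using N_ge by (simp add: power2_eq_square mult.assoc)
qed

text \<open>By this absorption identity, comparing multiples of \<open>C1\<close> and
  \<open>C2\<close> becomes a polynomial inequality.\<close>

lemma C1_C2: "(int l - 1) * C1 = (int N - 1) * C2"
proof -
  have "(l - 1) * ((N - 1) choose (l - 1)) = (N - 1) * ((N - 2) choose (l - 2))"
    using times_binomial_minus1_eq[of "l - 1" "N - 1"] l by (simp add: numeral_2_eq_2)
  then have "int (l - 1) * C1 = int (N - 1) * C2" by (metis of_nat_mult)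
  then show ?thesis using l l_le_N by (simp add: of_nat_diff)
qed

lemma C1_geI:
  assumes "(int l - 1) * a \<le> int N - 1"
  shows "a * C2 \<le> C1"
proof -
  have "(int l - 1) * (a * C2) \<le> (int N - 1) * C2"
    using mult_right_mono[OF assms, of C2] by (simp add: mult.assoc)
  then show ?thesis unfolding C1_C2[symmetric] using l by simp
qed

lemma C2_pos: "1 \<le> C2"
  using zero_less_binomial[of "l - 2" "N - 2"] l_le_N by linarith

text \<open>Pascal's rule applied \<open>i\<close> times, each step losing at most
  \<open>C2\<close>.\<close>

lemma C1_minus_le: "i < N \<Longrightarrow> C1 - int i * C2 \<le> int ((N - 1 - i) choose (l - 1))"
proof (induction i)
  case (Suc i)
  have "(N - 1 - i) choose (l - 1)
      = ((N - 1 - i - 1) choose (l - 1 - 1)) + ((N - 1 - i - 1) choose (l - 1))"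
    using Suc.prems l by (intro choose_reduce_nat) auto
  moreover have "(N - 1 - i - 1) choose (l - 1 - 1) \<le> (N - 2) choose (l - 2)"
    using binomial_right_mono[of "N - 1 - i - 1" "N - 2" "l - 2"] by (simp add: numeral_2_eq_2)
  moreover have "N - 1 - Suc i = N - 1 - i - 1" by simp
  ultimately have "int ((N - 1 - i) choose (l - 1)) \<le> C2 + int ((N - 1 - Suc i) choose (l - 1))"
    by simp
  then show ?case using Suc by (simp add: algebra_simps)
qed simp

lemma binomial_step: "j < l \<Longrightarrow> (N - j) choose l = ((N - 1 - j) choose (l - 1)) + ((N - Suc j) choose l)"
  using choose_reduce_nat[of "N - j" l] l_le_N by simp

text \<open>Pascal's rule telescopes the difference into \<open>p\<close> summands, each charged the
  worst loss \<open>(int l - 1) * C2\<close>.\<close>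

lemma drop_ge_linear:
  assumes "q + p \<le> l"
  shows "int ((N - (q + p)) choose l) + int p * (C1 - (int l - 1) * C2) \<le> int ((N - q) choose l)"
proof -
  define c where "c = C1 - (int l - 1) * C2"
  have "int ((N - (q + p)) choose l) + int p * c \<le> int ((N - q) choose l)"
    using assms
  proof (induction p)
    case (Suc p)
    have "c \<le> C1 - int (q + p) * C2"
      unfolding c_def using Suc.prems C2_pos by (intro diff_left_mono mult_right_mono) auto
    also have "\<dots> \<le> int ((N - 1 - (q + p)) choose (l - 1))"
      using Suc.prems l_le_N by (intro C1_minus_le) simp
    finally have "c \<le> int ((N - 1 - (q + p)) choose (l - 1))" .
    moreover have "int ((N - (q + p)) choose l)
        = int ((N - 1 - (q + p)) choose (l - 1)) + int ((N - (q + Suc p)) choose l)"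
      using binomial_step[of "q + p"] Suc.prems by simp
    moreover have "int (Suc p) * c = int p * c + c" by (simp add: algebra_simps)
    ultimately show ?case using Suc.IH Suc.prems by linarith
  qed simp
  then show ?thesis by (simp only: c_def)
qed

text \<open>The same telescoping, but the summand of index \<open>i\<close> is charged only
  \<open>i * C2\<close>; doubling avoids the fraction in the sum of the losses.\<close>

lemma drop_ge_quadratic:
  "p \<le> l \<Longrightarrow> 2 * int ((N - p) choose l) + 2 * int p * C1 - int p * (int p - 1) * C2
     \<le> 2 * int (N choose l)"
proof (induction p)
  case (Suc p)
  have "C1 - int p * C2 \<le> int ((N - 1 - p) choose (l - 1))"
    using Suc.prems l_le_N by (intro C1_minus_le) simp
  moreover have "int ((N - p) choose l) = int ((N - 1 - p) choose (l - 1)) + int ((N - Suc p) choose l)"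
    using binomial_step[of p] Suc.prems by simp
  ultimately show ?case using Suc by (simp add: algebra_simps)
qed simp

text \<open>This uses \<open>N2\<close>, the cubic bound in \<open>l\<close>. The factor is chosen
  so that two copies of \<open>C1\<close> absorb the quadratic loss in \<open>two_L_ge\<close> and
  leave \<open>2 * C2\<close>.\<close>

lemma two_C1_ge: "(2 + int l * (int l - 1)) * C2 \<le> 2 * C1"
proof -
  have "(int l - 1) * (2 + int l * (int l - 1)) \<le> 2 * int N - 2"
  proof -
    define e where "e = int l - 2"
    have e: "0 \<le> e" "int l = e + 2" using l by (auto simp: e_def)
    have "(int l + 2) * (int l + 1)^2 - 2 - (int l - 1) * (2 + int l * (int l - 1))
        = 6 * (e * e) + 26 * e + 30"
      unfolding e(2) by (simp add: algebra_simps power2_eq_square)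
    moreover have "0 \<le> e * e" using e by simp
    ultimately show ?thesis using N2_int e(1) by linarith
  qed
  then have "(int l - 1) * ((2 + int l * (int l - 1)) * C2) \<le> (2 * int N - 2) * C2"
    unfolding mult.assoc[symmetric] by (rule mult_right_mono) simp
  also have "\<dots> = (int l - 1) * (2 * C1)" using C1_C2 by (simp add: algebra_simps)
  finally show ?thesis using l by simp
qed

text \<open>The \<open>l\<close>-subsets of an \<open>N\<close>-set meeting a fixed \<open>l\<close>-set: the main term of \<^const>\<open>h1\<close> for \<open>N = n - d\<close>.\<close>

abbreviation "L \<equiv> int (N choose l) - int ((N - l) choose l)"

lemma two_L_ge: "2 * int l * C1 - int l * (int l - 1) * C2 \<le> 2 * L"
  using drop_ge_quadratic[of l] by simp

lemma L_ge: "(int l - 1) * C1 + C2 \<le> L"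
  using two_L_ge two_C1_ge by (simp add: algebra_simps)

text \<open>By \<open>C1_C2\<close> the lower bound in \<open>L_ge\<close> equals
  \<open>N * C2\<close>, so it suffices to multiply \<open>N1\<close> by \<open>C2\<close>.\<close>

lemma L_ge_choose_two: "int (((d + 2) choose 2) * (l + 1)^2 * ((N - 2) choose (l - 2))) \<le> L"
proof -
  have "((d + 2) choose 2) * (l + 1)^2 * ((N - 2) choose (l - 2)) \<le> N * ((N - 2) choose (l - 2))"
    using N1 by (rule mult_right_mono) simp
  then have "int (((d + 2) choose 2) * (l + 1)^2 * ((N - 2) choose (l - 2))) \<le> int N * C2"
    by (simp only: of_nat_le_iff flip: of_nat_mult)
  also have "\<dots> = (int l - 1) * C1 + C2" unfolding C1_C2 by (simp add: algebra_simps)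
  finally show ?thesis using L_ge by linarith
qed

text \<open>After one \<open>C1\<close> is set aside, the other \<open>l - 1\<close> copies in
  \<open>two_L_ge\<close>, worth \<open>(N - 1) * C2\<close>, pay for the quadratic loss and the
  branching term.\<close>

lemma L_ge_unique: "int (((N - 1) choose (l - 1)) + (d + 1) * (l * ((l + 1) * ((N - 2) choose (l - 2))))) \<le> L"
proof -
  have "2 * ((int d + 1) * (int l * (int l + 1))) + int l * (int l - 1) \<le> 2 * int N - 2"
  proof -
    define Q A where "Q = (int d + 1) * (int l + 1)^2" and "A = (int d + 1) * (int l * (int l + 1))"
    have "1 * (int l * int l + 1) \<le> Q"
      unfolding Q_def by (intro mult_mono) (auto simp: power2_eq_square algebra_simps)
    then have "int l * (int l - 1) + int l + 1 \<le> Q" by (simp add: algebra_simps)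
    moreover have "A \<le> Q"
      unfolding Q_def A_def by (intro mult_left_mono) (auto simp: power2_eq_square algebra_simps)
    moreover have "2 * Q \<le> int N" using N_ge_int by (simp only: Q_def mult.assoc)
    moreover have "0 \<le> int l * (int l - 1)" using l by simp
    ultimately show ?thesis unfolding A_def[symmetric] by linarith
  qed
  then have "(2 * ((int d + 1) * (int l * (int l + 1))) + int l * (int l - 1)) * C2 \<le> (2 * int N - 2) * C2"
    by (rule mult_right_mono) simp
  also have "\<dots> = 2 * ((int l - 1) * C1)" unfolding C1_C2 by (simp add: algebra_simps)
  finally show ?thesis using two_L_ge by (simp add: algebra_simps)
qed

text \<open>After cancelling \<open>N choose l\<close>, each of the \<open>p = l - q\<close>
  summands of the drop is worth at least \<open>(d + 2) * (l + 1) * C2\<close>, and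
  \<open>p * (d + 2) \<ge> p + 1 + d\<close> because \<open>p \<ge> 1\<close>.\<close>

lemma L_ge_intermediate:
  assumes q: "q < l"
  shows "int ((N choose l) - ((N - q) choose l) + (l + 1 - q + d) * ((l + 1) * ((N - 2) choose (l - 2)))) \<le> L"
proof -
  define p where "p = l - q"
  have p: "1 \<le> p" "l = q + p" using q by (auto simp: p_def)
  have "((int l - 1) + (int d + 2) * (int l + 1)) * C2 \<le> C1"
  proof (rule C1_geI)
    \<comment> \<open>Shifting \<open>l\<close> and \<open>d\<close> by 2 leaves a polynomial with nonnegative coefficients.\<close>
    define e where "e = int l - 2"
    have e: "0 \<le> e" "int l = e + 2" using l by (auto simp: e_def)
    define b where "b = int d - 2"
    have b: "0 \<le> b" "int d = b + 2" using d by (auto simp: b_def)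
    have "2 * (int d + 1) * (int l + 1)^2 - 1 - (int l - 1) * ((int l - 1) + (int d + 2) * (int l + 1))
      = e * e * b + e * e + 8 * (b * e) + 15 * b + 18 * e + 40 "
      unfolding b(2) e(2) by (simp add: algebra_simps power2_eq_square)
    moreover have "0 \<le> e * e * b" "0 \<le> e * e" "0 \<le> b * e" using b e by auto
    ultimately show "(int l - 1) * ((int l - 1) + (int d + 2) * (int l + 1)) \<le> int N - 1"
      using N_ge_int b(1) e(1) by linarith
  qed
  then have "int p * ((int d + 2) * (int l + 1) * C2) \<le> int p * (C1 - (int l - 1) * C2)"
    by (intro mult_left_mono) (auto simp: algebra_simps)
  also have "\<dots> \<le> int ((N - q) choose l) - int ((N - l) choose l)"
    using drop_ge_linear[of q p] p by simp
  finally have *: "int p * (int d + 2) * ((int l + 1) * C2) \<le> int ((N - q) choose l) - int ((N - l) choose l)"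
    by (simp only: mult.assoc)
  have "1 * (int d + 1) \<le> int p * (int d + 1)" using p(1) by (intro mult_right_mono) auto
  then have "int p + 1 + int d \<le> int p * (int d + 2)" by (simp add: algebra_simps)
  then have "(int p + 1 + int d) * ((int l + 1) * C2) \<le> int p * (int d + 2) * ((int l + 1) * C2)"
    by (rule mult_right_mono) simp
  moreover have "int (l + 1 - q + d) = int p + 1 + int d" using p by simp
  moreover have "(N - q) choose l \<le> N choose l" by (rule binomial_right_mono) simp
  ultimately show ?thesis
    using * by (simp only: of_nat_diff of_nat_mult of_nat_add of_nat_1)
qed

text \<open>With \<open>card_fam_A_le\<close> this excludes the families \<open>fam_A\<close> in
  part (i), where \<open>2 * t + 2 * r - 2 < k\<close> means \<open>d + 3 \<le> l\<close>.\<close>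

lemma L_ge_A: "d + 3 \<le> l \<Longrightarrow> int ((d + 2) * ((N - 1) choose (l - 1))) \<le> L"
proof -
  assume "d + 3 \<le> l"
  then have "(int d + 2) * C1 \<le> (int l - 1) * C1" by (intro mult_right_mono) auto
  then show ?thesis
    using L_ge C2_pos by (simp only: of_nat_mult of_nat_add of_nat_numeral)
qed

end

section \<open>The structure of large families\<close>

context saturated_family
begin

lemma star_of_covers_or_within_A:
  assumes T: "cover T" "card T = d + 1"
    and more: "cover T'" "card T' = d + 1" "T' \<noteq> T"
  shows "within_A \<or> (\<exists>M. star_of_covers V \<F> d l (T \<inter> T') M \<and> 2 \<le> card M)"
proof (cases "\<forall>S. cover S \<and> card S = d + 1 \<longrightarrow> T \<inter> T' \<subseteq> S")
  case False
  then show ?thesis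
    using within_A_if_covers_no_star[OF T more(1,2)] more(3) by blast
next
  case True
  define X where "X = T \<inter> T'"
  have fin: "finite T" "finite T'" using T more cover_sub finite_sub by blast+
  have ne: "card X \<noteq> d + 1"
  proof
    assume "card X = d + 1"
    then have "X = T" "X = T'" unfolding X_def using T(2) more(2) fin by (intro card_subset_eq; simp)+
    then show False using more(3) by blast
  qed
  moreover have "card X \<le> d + 1" using card_mono[of T X] fin T(2) by (auto simp: X_def)
  ultimately have cX: "card X = d" using covers_meet[OF T more(1,2)] unfolding X_def by simp
  have fX: "finite X" using fin by (simp add: X_def)
  define M where "M = {m \<in> V - X. cover (insert m X)}"
  have shape: "\<exists>m\<in>M. S = insert m X" if S: "cover S" "card S = d + 1" for S
  proof -
    have sub: "X \<subseteq> S" using True S unfolding X_def by blast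
    have "card (S - X) = 1" using sub fX S(2) cX by (simp add: card_Diff_subset)
    then obtain m where m: "S - X = {m}" by (rule card_1_singletonE)
    then have eq: "S = insert m X" using sub by blast
    have "m \<in> M" unfolding M_def using m S(1) cover_sub[OF S(1)] eq by blast
    then show ?thesis using eq by blast
  qed
  obtain m m' where m: "m \<in> M" "T = insert m X" "m' \<in> M" "T' = insert m' X"
    using shape[OF T] shape[OF more(1,2)] by blast
  have "{m, m'} \<subseteq> M" "m \<noteq> m'" using m more(3) by auto
  moreover have "finite M" using finite_V by (simp add: M_def)
  ultimately have "2 \<le> card M" using card_mono[of M "{m, m'}"] by simp
  moreover have "star_of_covers V \<F> d l X M"
  proof
    show "X \<subseteq> V" using cover_sub[OF T(1)] by (auto simp: X_def)
    show "cover S \<longleftrightarrow> (\<exists>m\<in>M. S = insert m X)" if "card S = d + 1" for S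
      using shape[OF _ that] by (auto simp: M_def)
    show "M \<noteq> {}" using m by blast
  qed (use cX in \<open>auto simp: M_def\<close>)
  ultimately show ?thesis unfolding X_def by blast
qed

lemma obtain_minimal_cover:
  obtains T where "cover T" "card T \<le> d + l" "\<forall>S. cover S \<longrightarrow> card T \<le> card S"
proof -
  have "d - 1 \<le> card V" using V_ge by simp
  then obtain A where A: "A \<in> \<F>" using not_all_contain_ge[of V] by blast
  obtain T where T: "cover T" "\<And>S. cover S \<Longrightarrow> card T \<le> card S"
    using ex_has_least_nat[of cover A card] mem_cover[OF A] by blast
  then show ?thesis using that mem_cover[OF A] memD(3)[OF A] by metis
qed

text \<open>The bounds belong, in order, to: no cover of size \<open>d + 1\<close>, exactly one, a
  star of \<open>q < l\<close> and a star of \<open>l\<close> of them. The last excludes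
  \<open>l = 2\<close>, where \<open>card_M_eq_l_cases\<close> gives \<open>within_A\<close>
  instead.\<close>

lemma structure_cases:
  assumes N1: "((d + 2) choose 2) * (l + 1)^2 \<le> card V - d"
  shows "within_A \<or> within_H
    \<or> card \<F> \<le> ((d + 2) choose 2) * (l + 1)^2 * ((card V - d - 2) choose (l - 2))
    \<or> card \<F> \<le> ((card V - d - 1) choose (l - 1))
        + (d + 1) * (l * ((l + 1) * ((card V - d - 2) choose (l - 2))))
    \<or> (\<exists>q. 2 \<le> q \<and> q < l \<and> card \<F> \<le> ((card V - d) choose l) - ((card V - d - q) choose l)
        + (l + 1 - q + d) * ((l + 1) * ((card V - d - 2) choose (l - 2))))
    \<or> l \<noteq> 2 \<and> card \<F> \<le> ((card V - d) choose l) - ((card V - d - l) choose l) + d * (card V - d - l)"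
proof (cases "\<exists>T. cover T \<and> card T = d + 1")
  case False
  obtain T where T: "cover T" "card T \<le> d + l" "\<forall>S. cover S \<longrightarrow> card T \<le> card S"
    by (rule obtain_minimal_cover)
  have "card T \<noteq> d + 1" using False T(1) by blast
  then obtain j where j: "card T = d + 2 + j"
    using cover_card_ge[OF T(1)] le_Suc_ex[of "d + 2" "card T"] by auto
  have "d \<le> card V" using V_ge by simp
  then have "((d + 2) choose 2) * (l + 1)^2 + d \<le> card V" using N1 le_diff_conv2 by blast
  then have "card \<F> \<le> ((d + 2) choose 2) * (l + 1)^2 * ((card V - d - 2) choose (l - 2))"
    using card_le_of_minimal_cover[OF T(1) refl _ T(3)[rule_format]]
      binomial_cover_bound_antimono[OF d_ge, of l "card V" j] T(2) unfolding j by simp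
  then show ?thesis by blast
next
  case True
  then obtain T where T: "cover T" "card T = d + 1" by blast
  show ?thesis
  proof (cases "\<exists>T'. cover T' \<and> card T' = d + 1 \<and> T' \<noteq> T")
    case False
    then show ?thesis using card_le_if_unique_cover[OF T] by blast
  next
    case True
    then obtain T' where T': "cover T'" "card T' = d + 1" "T' \<noteq> T" by blast
    from star_of_covers_or_within_A[OF T T'] consider within_A
      | M where "star_of_covers V \<F> d l (T \<inter> T') M" "2 \<le> card M" by blast
    then show ?thesis
    proof cases
      case 1
      then show ?thesis by blast
    next
      case 2
      interpret star_of_covers V \<F> d l "T \<inter> T'" M by (rule 2(1))
      consider "card M < l" | "card M = l" | "card M = l + 1" using card_M_le by linarith
      then show ?thesis
      proof cases
        case 1
        then show ?thesis using card_le_if_card_M_ge_2 2(2) by (meson less_imp_le)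
      next
        case 2
        then show ?thesis using card_M_eq_l_cases by blast
      next
        case 3
        then show ?thesis using within_H_if_card_M by blast
      qed
    qed
  qed
qed

end

section \<open>Reduction to saturated families\<close>

text \<open>Take a maximal 3-wise \<open>(d - 1)\<close>-intersecting family containing
  \<open>\<F>\<close>. A cover \<open>T\<close> of size \<open>d + 1\<close> loses at most one point
  in each member, so it keeps \<open>d - 1\<close> points in any two; hence adding a set through
  \<open>T\<close> preserves the condition.\<close>

lemma saturated_extension:
  assumes V: "finite V" "2 * (d + l) \<le> card V" and d: "2 \<le> d" and l: "2 \<le> l"
    and \<F>: "\<F> \<subseteq> [V]\<^bsup>(d + l)\<^esup>"
    and triple: "\<And>A B C. A \<in> \<F> \<Longrightarrow> B \<in> \<F> \<Longrightarrow> C \<in> \<F> \<Longrightarrow> d - 1 \<le> card (A \<inter> B \<inter> C)"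
    and nontriv: "\<And>S. S \<subseteq> V \<Longrightarrow> card S = d - 1 \<Longrightarrow> \<exists>A\<in>\<F>. \<not> S \<subseteq> A"
  obtains \<G> where "\<F> \<subseteq> \<G>" "saturated_family V \<G> d l"
proof -
  define P where "P \<G> \<longleftrightarrow> \<G> \<subseteq> [V]\<^bsup>(d + l)\<^esup> \<and> (\<forall>A\<in>\<G>. \<forall>B\<in>\<G>. \<forall>C\<in>\<G>. d - 1 \<le> card (A \<inter> B \<inter> C))" for \<G>
  have fin: "finite {\<G>. P \<G>}"
    by (rule finite_subset[of _ "Pow ([V]\<^bsup>(d + l)\<^esup>)"]) (auto simp: P_def finite_imp_finite_nsets V)
  have "\<F> \<in> {\<G>. P \<G>}" using \<F> triple by (simp add: P_def)
  from finite_has_maximal2[OF fin this] obtain \<G>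
    where \<G>: "P \<G>" "\<F> \<subseteq> \<G>" and max: "\<forall>\<H>. P \<H> \<longrightarrow> \<G> \<subseteq> \<H> \<longrightarrow> \<G> = \<H>"
    by (elim bexE) simp
  have sub: "\<G> \<subseteq> [V]\<^bsup>(d + l)\<^esup>"
    and tri: "\<And>A B C. A \<in> \<G> \<Longrightarrow> B \<in> \<G> \<Longrightarrow> C \<in> \<G> \<Longrightarrow> d - 1 \<le> card (A \<inter> B \<inter> C)"
    using \<G>(1) unfolding P_def by blast+
  have nontriv': "\<exists>A\<in>\<G>. \<not> S \<subseteq> A" if "S \<subseteq> V" "card S = d - 1" for S
    using nontriv[OF that] \<G>(2) by blast
  interpret pairwise_intersecting V \<G> d l
  proof
    fix A B assume A: "A \<in> \<G>" and B: "B \<in> \<G>"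
    have fin: "finite (A \<inter> B)" "A \<inter> B \<subseteq> V" using A sub by (auto simp: nsets_def)
    have "d - 1 \<le> card (A \<inter> B)" using tri[OF A B B] by (simp add: Int_assoc)
    moreover have "card (A \<inter> B) \<noteq> d - 1"
    proof
      assume eq: "card (A \<inter> B) = d - 1"
      then obtain C where C: "C \<in> \<G>" "\<not> A \<inter> B \<subseteq> C" using nontriv' fin(2) by blast
      then have "card (A \<inter> B \<inter> C) < card (A \<inter> B)" using fin(1) by (intro psubset_card_mono) auto
      then show False using tri[OF A B C(1)] eq by simp
    qed
    ultimately show "d \<le> card (A \<inter> B)" by simp
  qed (use V sub in auto)
  have "saturated_family V \<G> d l"
  proof
    fix T B assume T: "cover T" "card T = d + 1" and B: "B \<in> [V]\<^bsup>(d + l)\<^esup>" "T \<subseteq> B"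
    have fT: "finite T" using T(2) by (metis card.infinite add_eq_0_iff_both_eq_0 zero_neq_one)
    have miss: "card (T - A) \<le> 1" if "A \<in> \<G>" for A
      using that T fT by (auto simp: cover_def card_Diff_subset_Int)
    have with_B: "d - 1 \<le> card (B \<inter> (A \<inter> C))" if "A \<in> insert B \<G>" "C \<in> insert B \<G>" for A C
    proof -
      have le1: "card (T - D) \<le> 1" if "D \<in> insert B \<G>" for D
        using that B(2) miss[of D] by (cases "D = B") (simp_all add: Diff_eq_empty_iff[THEN iffD2])
      have "T - A \<inter> C = (T - A) \<union> (T - C)" by blast
      then have "card (T - A \<inter> C) \<le> 2"
        using card_Un_le[of "T - A" "T - C"] le1[OF that(1)] le1[OF that(2)] by simp
      then have "d - 1 \<le> card (T \<inter> (A \<inter> C))" using T(2) fT by (simp add: card_Diff_subset_Int)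
      also have "\<dots> \<le> card (B \<inter> (A \<inter> C))" using B by (intro card_mono) (auto simp: nsets_def)
      finally show ?thesis .
    qed
    have "P (insert B \<G>)"
      unfolding P_def
    proof (intro conjI ballI)
      fix A1 A2 A3 assume A: "A1 \<in> insert B \<G>" "A2 \<in> insert B \<G>" "A3 \<in> insert B \<G>"
      consider "A1 = B" | "A2 = B" | "A3 = B" | "A1 \<in> \<G>" "A2 \<in> \<G>" "A3 \<in> \<G>" using A by blast
      then show "d - 1 \<le> card (A1 \<inter> A2 \<inter> A3)"
      proof cases
        case 1
        then show ?thesis using with_B[OF A(2,3)] by (simp add: Int_assoc)
      next
        case 2
        then show ?thesis using with_B[OF A(1,3)] by (simp add: Int_ac)
      next
        case 3
        then show ?thesis using with_B[OF A(1,2)] by (simp add: Int_ac)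
      next
        case 4
        then show ?thesis by (rule tri)
      qed
    qed (use sub B in auto)
    then show "B \<in> \<G>" using max[rule_format, of "insert B \<G>"] by blast
  qed (use V d l tri nontriv' in auto)
  then show ?thesis using that \<G>(2) by blast
qed

lemma wise_intersecting_pred:
  assumes "wise_intersecting (Suc m) s \<F>" "0 < m" "\<F> \<subseteq> [{1..n}]\<^bsup>k\<^esup>" "\<not> trivial_family n s \<F>"
  shows "wise_intersecting m (s + 1) \<F>"
  unfolding wise_intersecting_def
proof
  fix f :: "nat \<Rightarrow> nat set" assume f: "f \<in> {1..m} \<rightarrow> \<F>"
  let ?I = "\<Inter>i\<in>{1..m}. f i"
  have f1: "f 1 \<in> \<F>" using f assms(2) by auto
  \<comment> \<open>The condition \<open>0 < m\<close> matters here: an empty intersection would be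
    \<open>UNIV\<close>.\<close>
  have "?I \<subseteq> f 1" using assms(2) by auto
  then have I: "?I \<subseteq> {1..n}" "finite ?I"
    using f1 assms(3) by (auto simp: nsets_def intro: finite_subset)
  have meet: "s \<le> card (?I \<inter> A)" if A: "A \<in> \<F>" for A
  proof -
    have eq: "{1..Suc m} = insert (Suc m) {1..m}" by auto
    have "f(Suc m := A) \<in> {1..Suc m} \<rightarrow> \<F>" using f A by (auto simp: Pi_iff le_Suc_eq)
    then have "s \<le> card (\<Inter>i\<in>{1..Suc m}. (f(Suc m := A)) i)"
      using assms(1) unfolding wise_intersecting_def by blast
    also have "(\<Inter>i\<in>{1..Suc m}. (f(Suc m := A)) i) = ?I \<inter> A" unfolding eq by auto
    finally show ?thesis .
  qed
  have "s \<le> card (?I \<inter> f 1)" by (rule meet[OF f1])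
  also have "\<dots> \<le> card ?I" using I(2) by (intro card_mono) auto
  finally have "s \<le> card ?I" .
  moreover have "card ?I \<noteq> s"
  proof
    assume c: "card ?I = s"
    have "?I \<subseteq> A" if "A \<in> \<F>" for A
    proof -
      have "?I \<inter> A = ?I" using meet[OF that] c I(2) by (intro card_subset_eq card_seteq) auto
      then show ?thesis by blast
    qed
    then have "trivial_family n s \<F>"
      unfolding trivial_family_def using I c by (intro bexI[of _ ?I]) (auto simp: nsets_def)
    then show False using assms(4) by blast
  qed
  ultimately show "s + 1 \<le> card ?I" by simp
qed

lemma trivial_family_mono:
  assumes "trivial_family n s' \<F>" "s \<le> s'"
  shows "trivial_family n s \<F>"
proof -
  obtain T where T: "T \<in> [{1..n}]\<^bsup>s'\<^esup>" "\<forall>F\<in>\<F>. T \<subseteq> F"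
    using assms(1) by (auto simp: trivial_family_def)
  then have "s \<le> card T" using assms(2) by (simp add: nsets_def)
  then obtain S where "S \<subseteq> T" "card S = s" "finite S" by (rule obtain_subset_with_card_n)
  then show ?thesis
    using T unfolding trivial_family_def by (intro bexI[of _ S]) (auto simp: nsets_def)
qed

text \<open>Each step trades one set for one point. With \<open>m = 3\<close> and
  \<open>j = r - 3\<close> it yields a 3-wise \<open>(t + r - 3)\<close>-intersecting
  family.\<close>

lemma wise_intersecting_diff:
  assumes "wise_intersecting (m + j) s \<F>" "0 < m" "\<F> \<subseteq> [{1..n}]\<^bsup>k\<^esup>" "\<not> trivial_family n s \<F>"
  shows "wise_intersecting m (s + j) \<F>"
  using assms(1,4)
proof (induction j arbitrary: s)
  case (Suc j)
  have "wise_intersecting (m + j) (s + 1) \<F>"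
    using Suc.prems assms(2,3) by (intro wise_intersecting_pred) auto
  moreover have "\<not> trivial_family n (s + 1) \<F>" using Suc.prems(2) trivial_family_mono by fastforce
  ultimately show ?case using Suc.IH[of "s + 1"] by simp
qed simp

lemma wise_intersecting_3D:
  assumes "wise_intersecting 3 s \<F>" "A \<in> \<F>" "B \<in> \<F>" "C \<in> \<F>"
  shows "s \<le> card (A \<inter> B \<inter> C)"
proof -
  let ?f = "\<lambda>i::nat. if i = 1 then A else if i = 2 then B else C"
  have eq: "{1..3} = {1, 2, 3 :: nat}" by auto
  have "?f \<in> {1..3} \<rightarrow> \<F>" using assms by auto
  then have "s \<le> card (\<Inter>i\<in>{1..3}. ?f i)" using assms(1) unfolding wise_intersecting_def by blast
  also have "(\<Inter>i\<in>{1..3}. ?f i) = A \<inter> B \<inter> C" unfolding eq by auto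
  finally show ?thesis .
qed

section \<open>Comparison with \<open>h1\<close>\<close>

lemma card_fam_A_le:
  assumes "Z \<in> [{1..n}]\<^bsup>(d + 2)\<^esup>"
  shows "card (fam_A n (d + l) (d + 1) Z) \<le> (d + 2) * ((n - d - 1) choose (l - 1))"
proof -
  have Z: "Z \<subseteq> {1..n}" "finite Z" "card Z = d + 2" using assms by (auto simp: nsets_def)
  let ?f = "\<lambda>S. {A \<in> [{1..n}]\<^bsup>(d + l)\<^esup>. S \<subseteq> A}"
  have "fam_A n (d + l) (d + 1) Z \<subseteq> (\<Union>S\<in>[Z]\<^bsup>(d + 1)\<^esup>. ?f S)"
  proof
    fix A assume "A \<in> fam_A n (d + l) (d + 1) Z"
    then have A: "A \<in> [{1..n}]\<^bsup>(d + l)\<^esup>" "d + 1 \<le> card (A \<inter> Z)" by (auto simp: fam_A_def)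
    obtain S where "S \<subseteq> A \<inter> Z" "card S = d + 1" "finite S"
      using A(2) by (rule obtain_subset_with_card_n)
    then show "A \<in> (\<Union>S\<in>[Z]\<^bsup>(d + 1)\<^esup>. ?f S)" using A(1) by (auto simp: nsets_def)
  qed
  then have "card (fam_A n (d + l) (d + 1) Z) \<le> card (\<Union>S\<in>[Z]\<^bsup>(d + 1)\<^esup>. ?f S)"
    using Z(2) by (intro card_mono) (auto simp: finite_imp_finite_nsets)
  also have "\<dots> \<le> card ([Z]\<^bsup>(d + 1)\<^esup>) * ((n - d - 1) choose (l - 1))"
  proof (rule card_UN_le_mult)
    fix S assume "S \<in> [Z]\<^bsup>(d + 1)\<^esup>"
    then have "S \<subseteq> Z" and cS: "card S = d + 1" by (simp_all add: nsets_def)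
    then have S: "S \<subseteq> {1..n}" using Z(1) subset_trans by metis
    have "card (?f S) \<le> (card {1..n} - card S) choose (d + l - card S)"
      by (rule card_supersets_le[OF _ S]) simp_all
    then show "card (?f S) \<le> (n - d - 1) choose (l - 1)" by (simp add: cS)
  qed (simp add: Z finite_imp_finite_nsets)
  also have "card ([Z]\<^bsup>(d + 1)\<^esup>) = d + 2"
    using Z(3) binomial_symmetric[of "d + 1" "d + 2"] by simp
  finally show ?thesis .
qed

text \<open>At \<open>c = n\<close> the third binomial has upper entry 0 and lower entry
  \<open>d + 2 * l - n \<le> 0\<close>, so it is 0 or 1; hence an inequality.\<close>

lemma h1_ge:
  assumes "d + l \<le> n" "d + 2 * l \<le> n"
  shows "int (n - d choose l) - int (n - d - l choose l) + int d * int (n - d - l) \<le> h1 n d (d + l) n"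
proof -
  have "nat (int n - int d) = n - d" "nat (int n - (int d + int l)) = n - d - l" using assms by simp_all
  then show ?thesis using assms by (auto simp: h1_def ibinom_def of_nat_diff)
qed

text \<open>The first two binomials differ by \<open>2 * (n - d) - 3\<close>, and the third is
  \<open>n - d - 3\<close>, its lower index being 1.\<close>

lemma h1_two:
  assumes "d + 4 \<le> n"
  shows "h1 n d (d + 2) (d + 2 + 1) = 3 * int (n - d) - 6 + int d"
proof -
  obtain m where m: "n = d + 4 + m" using assms le_Suc_ex by blast
  have "nat (4 + int m) = m + 4" "nat (2 + int m) = m + 2" by simp_all
  moreover have "int ((m + 4) choose 2) = int ((m + 2) choose 2) + 2 * int m + 5"
    by (simp add: eval_nat_numeral)
  ultimately show ?thesis by (simp add: h1_def ibinom_def m)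
qed

text \<open>For \<open>l \<noteq> 2\<close> the numerical cases of \<open>structure_cases\<close>
  give at most \<open>L + d * (n - d - l)\<close>, which does not exceed the threshold. For
  \<open>l = 2\<close> the threshold is linear in \<open>n\<close> and the cases are compared with
  it directly.\<close>

lemma (in saturated_family) within_A_or_within_H:
  assumes n: "n = card V" and b: "binomial_bounds (n - d) d l"
    and large: "l \<noteq> 2 \<and> h1 n d (d + l) n < int (card \<F>) \<or>
      l = 2 \<and> h1 n d (d + l) (d + l + 1) \<le> int (card \<F>)"
  shows "within_A \<or> within_H"
proof -
  interpret binomial_bounds "n - d" d l by (rule b)
  have "d + l \<le> n" "d + 2 * l \<le> n" using d_plus_l_le l by simp_all
  then have h1: "L + int d * int (n - d - l) \<le> h1 n d (d + l) n" by (rule h1_ge)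
  then have no_L: False if "l \<noteq> 2" "int (card \<F>) \<le> L"
    using that large by (smt (verit) of_nat_0_le_iff mult_nonneg_nonneg)
  have two: "h1 n d (d + 2) (d + 2 + 1) = 3 * int (n - d) - 6 + int d" if "l = 2"
    using d_plus_l_le that by (intro h1_two) simp
  consider within_A | within_H
    | (minimal) "card \<F> \<le> ((d + 2) choose 2) * (l + 1)^2 * ((n - d - 2) choose (l - 2))"
    | (unique) "card \<F> \<le> ((n - d - 1) choose (l - 1)) + (d + 1) * (l * ((l + 1) * ((n - d - 2) choose (l - 2))))"
    | (inter) q where "2 \<le> q" "q < l" "card \<F> \<le> ((n - d) choose l) - ((n - d - q) choose l)
        + (l + 1 - q + d) * ((l + 1) * ((n - d - 2) choose (l - 2)))"
    | (top) "l \<noteq> 2" "card \<F> \<le> ((n - d) choose l) - ((n - d - l) choose l) + d * (n - d - l)"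
    using structure_cases[folded n] N1 by blast
  then show ?thesis
  proof cases
    case minimal
    show ?thesis
    proof (cases "l = 2")
      case False
      then show ?thesis
        using no_L order_trans[OF of_nat_mono[OF minimal] L_ge_choose_two] by blast
    next
      case True
      \<comment> \<open>Here \<open>(l + 1)^2 = 9\<close> and
        \<open>(n - d - 2) choose (l - 2) = 1\<close>, so \<open>N1\<close> bounds the family by
        \<open>n - d\<close>.\<close>
      have "9 * ((d + 2) choose 2) \<le> n - d" "6 \<le> (d + 2) choose 2"
        using N1 True choose_two_ge[OF d] d by simp_all
      then show ?thesis using large minimal two True by simp
    qed
  next
    case unique
    show ?thesis
    proof (cases "l = 2")
      case False
      then show ?thesis
        using no_L order_trans[OF of_nat_mono[OF unique] L_ge_unique] by blast
    next
      case True
      have "18 * (d + 1) \<le> n - d" using N_ge True by simp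
      then show ?thesis using large unique two True by simp
    qed
  next
    case inter
    then show ?thesis
      using no_L order_trans[OF of_nat_mono[OF inter(3)] L_ge_intermediate[OF inter(2)]] by auto
  next
    case top
    have "(n - d - l) choose l \<le> (n - d) choose l" by (rule binomial_right_mono) simp
    then have "int (((n - d) choose l) - ((n - d - l) choose l) + d * (n - d - l))
        = int ((n - d) choose l) - int ((n - d - l) choose l) + int d * int (n - d - l)"
      by (simp only: of_nat_diff of_nat_add of_nat_mult)
    then show ?thesis using large top(1) of_nat_mono[OF top(2), where 'a = int] h1 by simp
  qed blast+
qed

section \<open>Translation of \<open>k\<close>, \<open>t\<close>, \<open>r\<close> into
  \<open>d\<close>, \<open>l\<close>\<close>

theorem theorem1p2:
  fixes n k t r :: nat and \<F> :: "nat set set"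
  assumes "n > 0" and "k > 0" and "t > 0" and "r \<ge> 3" and "t + r \<le> k"
    and "max (real ((t + r) choose 2)) ((real k - real t - real r + 4) / 2)
           * (real k - real t - real r + 3) ^ 2 + real t + real r - 2 \<le> real n"
    and "\<F> \<subseteq> [{1..n}]\<^bsup>k\<^esup>"
    and "wise_intersecting r t \<F>"
    and "\<not> trivial_family n t \<F>"
  shows
    "(2 * t + 2 * r - 2 < k \<and> int (card \<F>) > h1 n (t + r - 2) k n \<longrightarrow>
       (\<exists>M \<in> [{1..n}]\<^bsup>(k + 1)\<^esup>. \<exists>X \<in> [M]\<^bsup>(t + r - 2)\<^esup>. \<F> \<subseteq> fam_H n k (t + r - 1) X M))
     \<and>
     ((k \<le> 2 * t + 2 * r - 2 \<and> 2 * t + 2 * r - 2 < 2 * k - 2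
          \<and> int (card \<F>) > h1 n (t + r - 2) k n)
       \<or> (2 * t + 2 * r - 2 = 2 * k - 2 \<and> int (card \<F>) \<ge> h1 n (t + r - 2) k (k + 1))
       \<longrightarrow>
       (\<exists>M \<in> [{1..n}]\<^bsup>(k + 1)\<^esup>. \<exists>X \<in> [M]\<^bsup>(t + r - 2)\<^esup>. \<F> \<subseteq> fam_H n k (t + r - 1) X M)
       \<or> (\<exists>Z \<in> [{1..n}]\<^bsup>(t + r)\<^esup>. \<F> \<subseteq> fam_A n k (t + r - 1) Z))"
proof -
  define d l where "d = t + r - 2" and "l = k - d"
  have d: "2 \<le> d" and l: "2 \<le> l" and k: "k = d + l" and tr: "t + r = d + 2"
    using assms(3-5) by (auto simp: d_def l_def)
  have trd: "t + r - 2 = d" "t + r - 1 = d + 1" using tr by simp_all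
  have real_eqs: "real k - real t - real r + 4 = real l + 2"
      "real k - real t - real r + 3 = real l + 1" "real t + real r = real d + 2"
    using k tr by linarith+
  \<comment> \<open>In the new parameters the hypothesis on \<open>n\<close> splits into one
    inequality for each entry of the maximum, giving \<open>N1\<close> and
    \<open>N2\<close>.\<close>
  have "max (real ((d + 2) choose 2)) ((real l + 2) / 2) * (real l + 1)^2 + real d \<le> real n"
    using assms(6) unfolding real_eqs tr using real_eqs(3) by linarith
  moreover have "real ((d + 2) choose 2) * (real l + 1)^2
      \<le> max (real ((d + 2) choose 2)) ((real l + 2) / 2) * (real l + 1)^2"
    by (intro mult_right_mono) auto
  moreover have "(real l + 2) / 2 * (real l + 1)^2
      \<le> max (real ((d + 2) choose 2)) ((real l + 2) / 2) * (real l + 1)^2"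
    by (intro mult_right_mono) auto
  ultimately have "real ((d + 2) choose 2) * (real l + 1)^2 + real d \<le> real n"
    and "(real l + 2) * (real l + 1)^2 + 2 * real d \<le> 2 * real n" by linarith+
  then have "real (((d + 2) choose 2) * (l + 1)^2 + d) \<le> real n"
    and "real ((l + 2) * (l + 1)^2 + 2 * d) \<le> real (2 * n)"
    by (simp_all only: of_nat_add of_nat_mult of_nat_power of_nat_numeral of_nat_1)
  then have "((d + 2) choose 2) * (l + 1)^2 + d \<le> n" "(l + 2) * (l + 1)^2 + 2 * d \<le> 2 * n"
    by (simp_all only: of_nat_le_iff)
  then have b: "binomial_bounds (n - d) d l"
    using d l by unfold_locales (simp_all only: diff_mult_distrib2 le_diff_conv2 add_leD2 add_leE)
  interpret binomial_bounds "n - d" d l by (rule b)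
  have n: "2 * (d + l) \<le> n" "d \<le> n" using d_plus_l_le by simp_all

  \<comment> \<open>As \<open>r \<ge> 3\<close>, non-triviality passes from \<open>t\<close> to
    \<open>d - 1 = t + r - 3\<close>.\<close>
  have "t \<le> d - 1" using tr assms(4) by arith
  then have nontriv: "\<not> trivial_family n (d - 1) \<F>"
    using assms(9) trivial_family_mono by blast
  have "wise_intersecting (3 + (r - 3)) t \<F>" using assms(4,8) by simp
  then have "wise_intersecting 3 (t + (r - 3)) \<F>"
    by (rule wise_intersecting_diff[OF _ _ assms(7,9)]) simp
  moreover have "t + (r - 3) = d - 1" using tr assms(4) by arith
  ultimately have wise: "wise_intersecting 3 (d - 1) \<F>" by (simp only:)
  obtain \<G> where \<G>: "\<F> \<subseteq> \<G>" "saturated_family {1..n} \<G> d l"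
  proof (rule saturated_extension[of "{1..n}" d l \<F>])
    show "\<exists>A\<in>\<F>. \<not> S \<subseteq> A" if "S \<subseteq> {1..n}" "card S = d - 1" for S
      using nontriv nsetsI[OF _ that] unfolding trivial_family_def by blast
    show "d - 1 \<le> card (A \<inter> B \<inter> C)" if "A \<in> \<F>" "B \<in> \<F>" "C \<in> \<F>" for A B C
      using wise_intersecting_3D[OF wise that] .
  qed (use assms(7) k d l n in auto)
  interpret saturated_family "{1..n}" \<G> d l by (rule \<G>(2))
  \<comment> \<open>The lower bound on \<open>card \<F>\<close> carries over to \<open>\<G>\<close>,
    and containment of \<open>\<G>\<close> descends to \<open>\<F>\<close>.\<close>
  have le: "card \<F> \<le> card \<G>" using card_mono[OF finite_\<F> \<G>(1)] .

  have H: "\<exists>M \<in> [{1..n}]\<^bsup>(k + 1)\<^esup>. \<exists>X \<in> [M]\<^bsup>d\<^esup>. \<F> \<subseteq> fam_H n k (d + 1) X M" if within_H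
  proof -
    have "\<exists>M \<in> [{1..n}]\<^bsup>(k + 1)\<^esup>. \<exists>X \<in> [M]\<^bsup>d\<^esup>. \<G> \<subseteq> fam_H n k (d + 1) X M"
      using that by (simp only: within_H_def fam_H_def k)
    then show ?thesis using \<G>(1) by (meson subset_trans)
  qed
  have A: "\<exists>Z \<in> [{1..n}]\<^bsup>(t + r)\<^esup>. \<F> \<subseteq> fam_A n k (d + 1) Z" if within_A
  proof -
    have "\<exists>Z \<in> [{1..n}]\<^bsup>(t + r)\<^esup>. \<G> \<subseteq> fam_A n k (d + 1) Z"
      using that by (simp only: within_A_def fam_A_def k tr)
    then show ?thesis using \<G>(1) by (meson subset_trans)
  qed
  have main: "within_A \<or> within_H"
    if "l \<noteq> 2 \<and> h1 n d k n < int (card \<F>) \<or> l = 2 \<and> h1 n d k (k + 1) \<le> int (card \<F>)"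
    using that le unfolding k by (intro within_A_or_within_H[of n] b) auto
  have no_A: "\<not> within_A" if "d + 3 \<le> l" "h1 n d k n < int (card \<F>)"
  proof
    assume within_A
    then obtain Z where Z: "Z \<in> [{1..n}]\<^bsup>(d + 2)\<^esup>" "\<F> \<subseteq> fam_A n k (d + 1) Z" using A tr by auto
    have "finite (fam_A n k (d + 1) Z)" by (simp add: fam_A_def finite_imp_finite_nsets)
    then have "card \<F> \<le> card (fam_A n k (d + 1) Z)" using Z(2) by (rule card_mono)
    also have "\<dots> \<le> (d + 2) * ((n - d - 1) choose (l - 1))"
      unfolding k by (rule card_fam_A_le[OF Z(1)])
    finally have "int (card \<F>) \<le> L" using L_ge_A[OF that(1)] by linarith
    also have "\<dots> \<le> L + int d * int (n - d - l)" by simp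
    also have "\<dots> \<le> h1 n d k n"
      using d_plus_l_le n unfolding k by (intro h1_ge) simp_all
    finally show False using that(2) by simp
  qed
  show ?thesis
    unfolding trd
  proof (intro conjI impI)
    assume i: "2 * t + 2 * r - 2 < k \<and> h1 n d k n < int (card \<F>)"
    then have "d + 3 \<le> l" using tr k by linarith
    then show "\<exists>M \<in> [{1..n}]\<^bsup>(k + 1)\<^esup>. \<exists>X \<in> [M]\<^bsup>d\<^esup>. \<F> \<subseteq> fam_H n k (d + 1) X M"
      using main no_A H i d by auto
  next
    assume ii: "(k \<le> 2 * t + 2 * r - 2 \<and> 2 * t + 2 * r - 2 < 2 * k - 2 \<and> h1 n d k n < int (card \<F>))
       \<or> (2 * t + 2 * r - 2 = 2 * k - 2 \<and> h1 n d k (k + 1) \<le> int (card \<F>))"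
    \<comment> \<open>In terms of \<open>d\<close> and \<open>l\<close> the two sides are
      \<open>2 * d + 2\<close> and \<open>2 * d + 2 * l - 2\<close>.\<close>
    have "2 * t + 2 * r - 2 = 2 * k - 2 \<longleftrightarrow> l = 2" "2 * t + 2 * r - 2 < 2 * k - 2 \<longleftrightarrow> l \<noteq> 2"
      using tr k l by linarith+
    then have "within_A \<or> within_H" using ii main by blast
    then show "(\<exists>M \<in> [{1..n}]\<^bsup>(k + 1)\<^esup>. \<exists>X \<in> [M]\<^bsup>d\<^esup>. \<F> \<subseteq> fam_H n k (d + 1) X M)
       \<or> (\<exists>Z \<in> [{1..n}]\<^bsup>(t + r)\<^esup>. \<F> \<subseteq> fam_A n k (d + 1) Z)"
      using H A by blast
  qed
qed

end
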